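(* Let $0<q<1$ and let $a,b,c,d\in\mathbb{C}$ satisfy $a^2,b^2,c^2,d^2,ab,ac,ad,bc,bd,cd\notin\{q^{-k}\mid k=0,1,2,\ldots\}$. Define an operator $L$ acting on symmetric Laurent polynomials $f[z]$ by $$(Lf)[z]:=\Bigl((1-az)(1-bz)(1-cz)(1-dz)\,z^{-2}\,f[qz]-(1-a/z)(1-b/z)(1-c/z)(1-d/z)\,z^{2}\,f[q^{-1}z]\Bigr)\,(z-z^{-1})^{-1}.$$ Then: (i) $L$ sends symmetric Laurent polynomials of degree $n$ to symmetric Laurent polynomials of degree $n+1$, and, regarded as an operator on polynomials in $x=\tfrac12(z+z^{-1})$, it satisfies $L(x^n)=\gamma_n x^{n+1}+\text{terms of lower degree}$ with $\gamma_n=2(abcd\,q^n-q^{-n})$. (ii) $L$ is skew symmetric with respect to the Askey-Wilson inner product: $\langle Lf,g\rangle=-\langle f,Lg\rangle$. (iii) The Askey-Wilson polynomials $p_n$ satisfy the structure relation $$(Lp_n)[z]=-\frac{(1-abcdq^{n-1})\,p_{n+1}[z]}{q^n(1-abcdq^{2n-1})}+(1-abq^{n-1})(1-acq^{n-1})(1-adq^{n-1})(1-bcq^{n-1})(1-bdq^{n-1})(1-cdq^{n-1})\,\frac{(1-q^n)\,p_{n-1}[z]}{q^{n-1}(1-abcdq^{2n-1})}.$$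
   Context: Symmetric Laurent polynomials $f[z]=\sum_{k=-n}^n c_kz^k$ (where $c_k=c_{-k}$) are related to ordinary polynomials $f(x)$ in $x=\tfrac12(z+z^{-1})$ by $f(\tfrac12(z+z^{-1}))=f[z]$. $q$-Pochhammer symbols: $(u;q)_n=\prod_{j=0}^{n-1}(1-uq^j)$, $(u;q)_\infty=\prod_{j\ge0}(1-uq^j)$, $(u_1,\dots,u_r;q)_n=\prod_i(u_i;q)_n$ (also for $n=\infty$). The Askey-Wilson polynomials are $$p_n[z]=p_n\bigl(\tfrac12(z+z^{-1});a,b,c,d\mid q\bigr):=\frac{(ab,ac,ad;q)_n}{a^n}\sum_{k=0}^n\frac{(q^{-n},q^{n-1}abcd,az,az^{-1};q)_k}{(ab,ac,ad,q;q)_k}\,q^k.$$ The Askey-Wilson inner product, for which these polynomials are orthogonal, is $$\langle f,g\rangle:=\frac1{4\pi i}\oint_C f[z]\,g[z]\,w(z)\,\frac{dz}z,\qquad w(z):=\frac{(z^2,z^{-2};q)_\infty}{(az,az^{-1},bz,bz^{-1},cz,cz^{-1},dz,dz^{-1};q)_\infty},$$ where $C$ is the unit circle traversed in positive direction with suitable deformations to separate the sequences of poles converging to zero from the sequences of poles diverging to $\infty$.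
   Formalization: In (i), degree exactly n+1 is claimed only if γ_n≠0 (it fails for a=b=c=d=i, n=0); degree ≤ n+1 always holds. In (iii), abcdq^{2n-1}≠1 is assumed, since otherwise the right side is undefined for n≥1; for n=0, Lp_0=-p_1 is stated without this assumption. *)

theory Defs
  imports "HOL-Complex_Analysis.Complex_Analysis"
begin

definition qpoch :: "complex list \<Rightarrow> complex \<Rightarrow> nat \<Rightarrow> complex" where
  "qpoch us q n = (\<Prod>u\<leftarrow>us. \<Prod>j<n. 1 - u * q ^ j)"

definition qpoch_inf :: "complex list \<Rightarrow> complex \<Rightarrow> complex" where
  "qpoch_inf us q = (\<Prod>u\<leftarrow>us. \<Prod>j. 1 - u * q ^ j)"

(* Laurent polynomials are functions on the nonzero complex numbers; their value at 0 is
   irrelevant throughout. *)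
definition sym_laurent_coeffs :: "nat \<Rightarrow> (int \<Rightarrow> complex) \<Rightarrow> (complex \<Rightarrow> complex) \<Rightarrow> bool" where
  "sym_laurent_coeffs n c f \<longleftrightarrow>
     (\<forall>k. c (- k) = c k) \<and> (\<forall>z. z \<noteq> 0 \<longrightarrow> f z = (\<Sum>k = - int n..int n. c k * z powi k))"

(* degree at most n *)
definition sym_laurent_le :: "nat \<Rightarrow> (complex \<Rightarrow> complex) \<Rightarrow> bool" where
  "sym_laurent_le n f \<longleftrightarrow> (\<exists>c. sym_laurent_coeffs n c f)"

(* degree exactly n *)
definition sym_laurent_deg :: "nat \<Rightarrow> (complex \<Rightarrow> complex) \<Rightarrow> bool" where
  "sym_laurent_deg n f \<longleftrightarrow> (\<exists>c. sym_laurent_coeffs n c f \<and> c (int n) \<noteq> 0)"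

definition sym_laurent :: "(complex \<Rightarrow> complex) \<Rightarrow> bool" where
  "sym_laurent f \<longleftrightarrow> (\<exists>n. sym_laurent_le n f)"

definition laurent_of_poly :: "complex poly \<Rightarrow> complex \<Rightarrow> complex" where
  "laurent_of_poly p z = poly p ((z + inverse z) / 2)"

(* The quotient by z - 1/z has removable singularities at z = 1 and z = -1;
   remove_sings fills in the limits there and changes no value at other nonzero z. *)
definition aw_L ::
  "complex \<Rightarrow> complex \<Rightarrow> complex \<Rightarrow> complex \<Rightarrow> complex \<Rightarrow> (complex \<Rightarrow> complex) \<Rightarrow> complex \<Rightarrow> complex" where
  "aw_L q a b c d f = remove_sings (\<lambda>z.
     ((1 - a * z) * (1 - b * z) * (1 - c * z) * (1 - d * z) * z powi (-2) * f (q * z)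
      - (1 - a / z) * (1 - b / z) * (1 - c / z) * (1 - d / z) * z\<^sup>2 * f (inverse q * z))
     * inverse (z - inverse z))"

definition aw_poly_formula ::
  "complex \<Rightarrow> complex \<Rightarrow> complex \<Rightarrow> complex \<Rightarrow> complex \<Rightarrow> nat \<Rightarrow> complex \<Rightarrow> complex" where
  "aw_poly_formula q a b c d n z =
     qpoch [a * b, a * c, a * d] q n / a ^ n *
     (\<Sum>k\<le>n. qpoch [q powi (- int n), q powi (int n - 1) * a * b * c * d, a * z, a * inverse z] q k
            / qpoch [a * b, a * c, a * d, q] q k * q ^ k)"

(* For fixed z the formula is a polynomial in a, b, c, d divided by a ^ n, and the division is
   exact. At a = 0, where the formula reads 0/0, its value is therefore the limit. *)
definition aw_poly ::
  "complex \<Rightarrow> complex \<Rightarrow> complex \<Rightarrow> complex \<Rightarrow> complex \<Rightarrow> nat \<Rightarrow> complex \<Rightarrow> complex" where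
  "aw_poly q a b c d n z =
     (if a = 0 then Lim (at 0) (\<lambda>a'. aw_poly_formula q a' b c d n z)
      else aw_poly_formula q a b c d n z)"

definition aw_weight ::
  "complex \<Rightarrow> complex \<Rightarrow> complex \<Rightarrow> complex \<Rightarrow> complex \<Rightarrow> complex \<Rightarrow> complex" where
  "aw_weight q a b c d z =
     qpoch_inf [z\<^sup>2, z powi (-2)] q /
     qpoch_inf [a * z, a * inverse z, b * z, b * inverse z,
                c * z, c * inverse z, d * z, d * inverse z] q"

(* The deformed unit circle: a closed path that winds once around 0 and around each pole e q^k
   of the sequences converging to 0, and not at all around the poles 1/(e q^k) of the sequences
   diverging to infinity, e in {a,b,c,d}. By Cauchy's theorem these winding numbers determine
   the integrals below, so simplicity of the curve need not be required. When |a|,|b|,|c|,|d| < 1,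
   the unit circle itself qualifies. *)
definition aw_contour ::
  "complex \<Rightarrow> complex \<Rightarrow> complex \<Rightarrow> complex \<Rightarrow> complex \<Rightarrow> (real \<Rightarrow> complex) \<Rightarrow> bool" where
  "aw_contour q a b c d C \<longleftrightarrow>
     valid_path C \<and> pathfinish C = pathstart C \<and>
     0 \<notin> path_image C \<and> winding_number C 0 = 1 \<and>
     (\<forall>e\<in>{a, b, c, d}. \<forall>k::nat.
        e * q ^ k \<notin> path_image C \<and> winding_number C (e * q ^ k) = 1 \<and>
        (e \<noteq> 0 \<longrightarrow> inverse (e * q ^ k) \<notin> path_image C \<and>
                   winding_number C (inverse (e * q ^ k)) = 0))"

definition aw_inner ::
  "(real \<Rightarrow> complex) \<Rightarrow> complex \<Rightarrow> complex \<Rightarrow> complex \<Rightarrow> complex \<Rightarrow> complex \<Rightarrow>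
   (complex \<Rightarrow> complex) \<Rightarrow> (complex \<Rightarrow> complex) \<Rightarrow> complex" where
  "aw_inner C q a b c d f g =
     1 / (4 * of_real pi * \<i>) * contour_integral C (\<lambda>z. f z * g z * aw_weight q a b c d z / z)"

end

(*
  Write w(z) = Delta(z) Delta(1/z) with Delta(z) = (z^2;q) / (az,bz,cz,dz;q), all products infinite.

  (i) The numerator of Lf is a Laurent polynomial antisymmetric under z -> 1/z, hence divisible
  by z - 1/z with symmetric quotient; Chebyshev polynomials make degree and leading coefficient
  visible.

  (ii) Since Delta(qz) (1-z^2) (1-qz^2) = Delta(z) (1-az)(1-bz)(1-cz)(1-dz), the integrand of <Lf,g>
  is a difference of F(f,g)(z) and of F(g,f)(z/q)/q. Skew symmetry thus says that integrating
  F over C and over C/q gives the same result, which is Cauchy's theorem because the two contours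
  have equal winding numbers around all singularities of F. An admissible contour is a small
  circle around 0 joined to small circles around the finitely many remaining poles that
  have to be encircled.

  (iii) For a <> 0, L acts on the basis (az,a/z;q)_k by a three-term relation with explicit
  coefficients, so that the structure relation becomes a rational identity for the coefficients of
  p_n. At a = 0 it follows by passing to the limit.
*)
theory Submission
  imports Defs
begin

section \<open>Loops with prescribed winding numbers\<close>

text \<open>The parameters may have any modulus, so the unit circle need not be admissible, and the
  poles accumulate at 0, so 0 is not an isolated singularity. Winding numbers handle both: the
  domain is the complement of a countable closed set, hence connected, and the global Cauchy theorem
  only asks for equal winding numbers around all omitted points, 0 included.

  Division is postponed. Identities are proved for the numerator of Lf, before dividing by z - 1/z,
  and multiplied by 1 - abcd q^(2n-1); quotients are formed at the end, the values at z = 1 and z =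
  -1 by continuity.

  At a = 0 even the existence of the limit of p_n needs an argument, because of the division by a^n.
  The structure relation gives p_(n+1) from p_n and p_(n-1), but only where z^2 differs from 1,
  while the numerator at z involves p_n at qz and z/q, which may be 1 or -1. Interpolation closes
  this gap: for polynomials of bounded degree, convergence at enough points implies convergence
  everywhere.\<close>

text \<open>The loop runs through \<open>g1\<close>, along a connecting path, through
  \<open>g2\<close> and back along the same path, whose two passages cancel. In this way a sum of
  cycles becomes one closed path, the form in which Cauchy's theorem is applied.\<close>

lemma loop_join:
  fixes g1 g2 :: "real \<Rightarrow> complex"
  assumes S: "open S" "connected S"
    and g1: "valid_path g1" "pathfinish g1 = pathstart g1" "path_image g1 \<subseteq> S"
    and g2: "valid_path g2" "pathfinish g2 = pathstart g2" "path_image g2 \<subseteq> S"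
  shows "\<exists>g. valid_path g \<and> pathfinish g = pathstart g \<and> path_image g \<subseteq> S \<and>
    (\<forall>w. w \<notin> S \<longrightarrow> winding_number g w = winding_number g1 w + winding_number g2 w) \<and>
    (\<forall>f. f holomorphic_on S \<longrightarrow>
       contour_integral g f = contour_integral g1 f + contour_integral g2 f)"
proof -
  have "pathstart g1 \<in> S" "pathstart g2 \<in> S"
    using g1 g2 by auto
  then obtain p where p: "polynomial_function p" "path_image p \<subseteq> S"
      "pathstart p = pathstart g1" "pathfinish p = pathstart g2"
    using connected_open_polynomial_connected[OF S] by metis
  have vp: "valid_path p"
    using p(1) by (rule valid_path_polynomial_function)
  define g where "g = (g1 +++ p) +++ (g2 +++ reversepath p)"
  note paths = g1(1) g2(1) vp
  show ?thesis
  proof (intro exI[of _ g] conjI allI impI)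
    show "valid_path g" "pathfinish g = pathstart g"
      using paths g1(2) g2(2) p by (auto simp: g_def)
    show "path_image g \<subseteq> S"
      using g1 g2 p by (auto simp: g_def path_image_join)
    show "winding_number g w = winding_number g1 w + winding_number g2 w" if "w \<notin> S" for w
    proof -
      have "w \<notin> path_image g1" "w \<notin> path_image g2" "w \<notin> path_image p"
        using that g1 g2 p by auto
      then show ?thesis
        using g1 g2 p vp
        by (simp add: g_def winding_number_join winding_number_reversepath valid_path_imp_path
            path_image_join)
    qed
    show "contour_integral g f = contour_integral g1 f + contour_integral g2 f"
      if "f holomorphic_on S" for f
    proof -
      have "f contour_integrable_on g1" "f contour_integrable_on g2" "f contour_integrable_on p"
        using that S g1 g2 p vp by (auto intro: contour_integrable_holomorphic_simple)
      then show ?thesis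
        using g1 g2 p vp
        by (simp add: g_def contour_integrable_reversepath contour_integral_reversepath)
    qed
  qed
qed

text \<open>Joining \<open>g1\<close> to the reverse of \<open>g2\<close> gives a loop with winding
  number 0 around every point outside \<open>S\<close>, and the global Cauchy theorem applies to
  it.\<close>

lemma contour_integral_eq_homologous_loops:
  assumes S: "open S" "connected S"
    and g1: "valid_path g1" "pathfinish g1 = pathstart g1" "path_image g1 \<subseteq> S"
    and g2: "valid_path g2" "pathfinish g2 = pathstart g2" "path_image g2 \<subseteq> S"
    and wn: "\<And>w. w \<notin> S \<Longrightarrow> winding_number g1 w = winding_number g2 w"
    and f: "f holomorphic_on S"
  shows "contour_integral g1 f = contour_integral g2 f"
proof -
  have rg2: "valid_path (reversepath g2)"
      "pathfinish (reversepath g2) = pathstart (reversepath g2)" "path_image (reversepath g2) \<subseteq> S"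
    using g2 by auto
  obtain g where g: "valid_path g" "pathfinish g = pathstart g" "path_image g \<subseteq> S"
    "\<And>w. w \<notin> S \<Longrightarrow> winding_number g w = winding_number g1 w + winding_number (reversepath g2) w"
    "\<And>f. f holomorphic_on S \<Longrightarrow>
       contour_integral g f = contour_integral g1 f + contour_integral (reversepath g2) f"
    using loop_join[OF S g1 rg2] by metis
  have "winding_number g w = 0" if "w \<notin> S" for w
  proof -
    have "w \<notin> path_image g2"
      using that g2 by auto
    then show ?thesis
      using g(4)[OF that] wn[OF that] g2(1)
      by (simp add: winding_number_reversepath valid_path_imp_path)
  qed
  then have "contour_integral g f = 0"
    using Cauchy_theorem_global[OF S(1) f g(1-3)] contour_integral_unique by blast
  then show ?thesis
    using g(5)[OF f] g2(1) by (simp add: contour_integral_reversepath)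
qed

lemma closed_Un_inverse_image:
  fixes K K' :: "complex set"
  assumes "closed K" "closed K'" "0 \<in> K"
  shows "closed (K \<union> inverse ` K')"
proof -
  have "open ((- {0}) \<inter> inverse -` (- K'))"
    using assms(2) by (intro continuous_open_preimage continuous_intros) auto
  moreover have "- (K \<union> inverse ` K') = ((- {0}) \<inter> inverse -` (- K')) \<inter> - K"
    using assms(3) by (auto simp: image_iff) (metis inverse_inverse_eq)
  ultimately show ?thesis
    using assms(1) by (metis closed_def open_Int)
qed

lemma separating_loop_exists:
  fixes K :: "complex set"
  assumes K: "compact K" "0 \<in> K" and fin: "\<And>r. r > 0 \<Longrightarrow> finite (K - ball 0 r)"
    and disj: "K \<inter> inverse ` (K - {0}) = {}"
  obtains C where "valid_path C" "pathfinish C = pathstart C" "path_image C \<inter> (K \<union> inverse ` K) = {}"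
    "\<And>w. w \<in> K \<Longrightarrow> winding_number C w = 1"
    "\<And>w. w \<in> inverse ` (K - {0}) \<Longrightarrow> winding_number C w = 0"
proof -
  define T where "T = K \<union> inverse ` K"
  \<comment> \<open>Countability serves twice: the complement of a closed countable set in the plane
    is connected, and a radius can be chosen that differs from the modulus of every point of
    \<open>K\<close>.\<close>
  have count: "countable K"
  proof -
    have "K \<subseteq> insert 0 (\<Union>n. K - ball 0 (inverse (real (Suc n))))"
    proof
      fix w assume "w \<in> K"
      show "w \<in> insert 0 (\<Union>n. K - ball 0 (inverse (real (Suc n))))"
      proof (cases "w = 0")
        case False
        then obtain n where "inverse (real (Suc n)) < norm w"
          using reals_Archimedean[of "norm w"] by auto
        then show ?thesis
          using \<open>w \<in> K\<close> by (auto intro!: exI[of _ n])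
      qed auto
    qed
    then show ?thesis
      by (rule countable_subset) (intro countable_insert countable_UN[OF countableI_type] countable_finite fin, simp)
  qed
  have T: "closed T" "countable T"
    using closed_Un_inverse_image[of K K] K count by (auto simp: T_def compact_imp_closed)
  have S: "open (- T)" "connected (- T)"
    using T by (auto intro!: path_connected_imp_connected path_connected_complement_countable)
  obtain B where B: "B > 0" "\<And>w. w \<in> K \<Longrightarrow> norm w \<le> B"
    using K(1) by (meson bounded_pos compact_imp_bounded)
  \<comment> \<open>Inverses of points of \<open>K\<close> have modulus at least 1/B, so a circle of
    radius below 1/B leaves them outside. The circle must also miss \<open>K\<close>, which excludes
    only countably many radii.\<close>
  obtain r where r: "0 < r" "r < inverse B" "r \<notin> norm ` K"
  proof -
    have "uncountable ({0<..<inverse B} - norm ` K)"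
      using B(1) count by (intro uncountable_minus_countable) (auto simp: uncountable_open_interval)
    then obtain r where "r \<in> {0<..<inverse B} - norm ` K"
      by (metis countable_empty equals0I)
    with that[of r] show ?thesis
      by simp
  qed
  have inv_large: "r < norm w" if "w \<in> inverse ` (K - {0})" for w
  proof -
    from that obtain v where v: "v \<in> K" "v \<noteq> 0" "w = inverse v"
      by auto
    have "inverse B \<le> inverse (norm v)"
      using B v by (intro le_imp_inverse_le) auto
    then show ?thesis
      using r v by (simp add: norm_inverse)
  qed
  \<comment> \<open>Since \<open>K\<close> accumulates only at 0, it remains closed when
    \<open>p\<close> is removed; and \<open>p\<close> is no inverse of a point of \<open>K\<close>
    by disjointness. Hence \<open>p\<close> has positive distance from the rest of
    \<open>T\<close>.\<close>
  have isolated: "\<exists>e>0. cball p e \<inter> T = {p}" if p: "p \<in> K" "p \<noteq> 0" for p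
  proof -
    have "K - {p} = (K \<inter> cball 0 (norm p / 2)) \<union> ((K - cball 0 (norm p / 2)) - {p})"
      using p by auto
    moreover have "finite ((K - cball 0 (norm p / 2)) - {p})"
      using p by (intro finite_subset[OF _ fin[of "norm p / 2"]]) auto
    ultimately have "closed (K - {p})"
      using K(1) by (metis closed_Int closed_Un closed_cball compact_imp_closed finite_imp_closed)
    then have "closed ((K - {p}) \<union> inverse ` K)"
      using K p by (intro closed_Un_inverse_image) (auto simp: compact_imp_closed)
    moreover have "p \<notin> (K - {p}) \<union> inverse ` K"
      using disj p by (auto simp: image_iff)
    ultimately obtain e where e: "e > 0" "ball p e \<subseteq> - ((K - {p}) \<union> inverse ` K)"
      using open_contains_ball by (metis ComplI open_Compl)
    have "cball p (e/2) \<subseteq> ball p e"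
      using e by auto
    then have "cball p (e/2) \<inter> T = {p}"
      using e p by (auto simp: T_def)
    with e show ?thesis
      by (intro exI[of _ "e/2"]) auto
  qed
  \<comment> \<open>The induction adds one small circle for each pole outside the central disc. The
    winding numbers are prescribed on all of \<open>T\<close>, so that each new circle is seen to
    leave the earlier values unchanged.\<close>
  have loops: "\<exists>C. valid_path C \<and> pathfinish C = pathstart C \<and> path_image C \<subseteq> - T \<and>
     (\<forall>w\<in>T. winding_number C w = (if w \<in> ball 0 r \<union> F then 1 else 0))"
    if "finite F" "F \<subseteq> K - ball 0 r" for F
    using that
  proof (induction F)
    case empty
    have avoid: "path_image (circlepath 0 r) \<subseteq> - T"
      using r inv_large by (force simp: T_def sphere_def)
    have "winding_number (circlepath 0 r) w = (if w \<in> ball 0 r then 1 else 0)" if "w \<in> T" for w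
    proof (cases "w \<in> ball 0 r")
      case True
      then show ?thesis
        by (simp add: winding_number_circlepath)
    next
      case False
      then have "w \<notin> cball 0 r"
        using that avoid r by (auto simp: sphere_def)
      then show ?thesis
        using False r winding_number_zero_outside[of "circlepath 0 r" "cball 0 r"] by auto
    qed
    with avoid show ?case
      by (intro exI[of _ "circlepath 0 r"]) auto
  next
    case (insert p F)
    then obtain C where C: "valid_path C" "pathfinish C = pathstart C" "path_image C \<subseteq> - T"
      "\<And>w. w \<in> T \<Longrightarrow> winding_number C w = (if w \<in> ball 0 r \<union> F then 1 else 0)"
      by auto
    have p: "p \<in> K" "p \<noteq> 0" "p \<notin> ball 0 r"
      using insert r by auto
    then obtain e where e: "e > 0" "cball p e \<inter> T = {p}"
      using isolated by blast
    have avoid: "path_image (circlepath p e) \<subseteq> - T"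
      using e by (auto simp: sphere_def)
    have loop: "pathfinish (circlepath p e) = pathstart (circlepath p e)"
      by simp
    obtain g where g: "valid_path g" "pathfinish g = pathstart g" "path_image g \<subseteq> - T"
      "\<And>w. w \<notin> - T \<Longrightarrow> winding_number g w = winding_number C w + winding_number (circlepath p e) w"
      "\<And>f. f holomorphic_on - T \<Longrightarrow>
         contour_integral g f = contour_integral C f + contour_integral (circlepath p e) f"
      using loop_join[OF S C(1-3) valid_path_circlepath loop avoid] by metis
    have "winding_number (circlepath p e) w = (if w = p then 1 else 0)" if "w \<in> T" for w
    proof (cases "w = p")
      case True
      then show ?thesis
        using e by (simp add: winding_number_circlepath)
    next
      case False
      then have "w \<notin> cball p e"
        using that e(2) by blast
      then show ?thesis
        using False e winding_number_zero_outside[of "circlepath p e" "cball p e"] by auto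
    qed
    then have "\<forall>w\<in>T. winding_number g w = (if w \<in> ball 0 r \<union> insert p F then 1 else 0)"
      using g(4) C(4) p insert.hyps by simp
    with g(1-3) show ?case
      by blast
  qed
  obtain C where C: "valid_path C" "pathfinish C = pathstart C" "path_image C \<subseteq> - T"
     "\<And>w. w \<in> T \<Longrightarrow> winding_number C w = (if w \<in> ball 0 r \<union> (K - ball 0 r) then 1 else 0)"
    using loops[OF fin[OF r(1)]] by auto
  show ?thesis
  proof
    show "path_image C \<inter> (K \<union> inverse ` K) = {}"
      using C(3) by (auto simp: T_def)
    show "winding_number C w = 1" if "w \<in> K" for w
      using C(4)[of w] that by (auto simp: T_def)
    show "winding_number C w = 0" if "w \<in> inverse ` (K - {0})" for w
    proof -
      have "w \<in> T" "w \<notin> K"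
        using that disj by (auto simp: T_def)
      then show ?thesis
        using C(4) inv_large[OF that] by simp
    qed
  qed (use C in auto)
qed

section \<open>Infinite \<open>q\<close>-shifted factorials and the weight\<close>

definition qinf :: "complex \<Rightarrow> complex \<Rightarrow> complex" where
  "qinf q u = (\<Prod>j. 1 - u * q ^ j)"

lemma convergent_prod_qinf:
  fixes q u :: complex
  assumes "norm q < 1"
  shows "convergent_prod (\<lambda>j. 1 - u * q ^ j)"
proof -
  have "summable (\<lambda>j. norm u * norm q ^ j)"
    using assms by (intro summable_mult summable_geometric) auto
  moreover have "(\<lambda>j. norm u * norm q ^ j) = (\<lambda>j. norm (1 - u * q ^ j - 1))"
    by (simp add: norm_mult norm_power fun_eq_iff)
  ultimately have "summable (\<lambda>j. norm (1 - u * q ^ j - 1))"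
    by simp
  then have "abs_convergent_prod (\<lambda>j. 1 - u * q ^ j)"
    by (simp add: abs_convergent_prod_conv_summable)
  then show ?thesis
    by (rule abs_convergent_prod_imp_convergent_prod)
qed

lemma qinf_rec:
  assumes "norm q < 1"
  shows "qinf q u = (1 - u) * qinf q (u * q)"
proof -
  have "(\<lambda>j. 1 - u * q ^ j) has_prod ((\<Prod>k<1. 1 - u * q ^ k) * (\<Prod>k. 1 - u * q ^ (k + 1)))"
    by (intro has_prod_ignore_initial_segment' convergent_prod_qinf assms)
  then show ?thesis
    by (simp add: qinf_def has_prod_unique[symmetric] mult.assoc)
qed

lemma qinf_nonzero:
  assumes "norm q < 1" "\<And>j. u * q ^ j \<noteq> 1"
  shows "qinf q u \<noteq> 0"
  unfolding qinf_def using assms by (intro prodinf_nonzero convergent_prod_qinf) auto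

lemma qinf_1: "norm q < 1 \<Longrightarrow> qinf q 1 = 0"
  by (simp add: qinf_rec[of q 1])

text \<open>On a disc of radius r the terms differ from 1 by at most r |q|^j, so the partial
  products converge uniformly there. Every point lies in such a disc.\<close>

lemma qinf_holomorphic:
  assumes q: "norm q < 1"
  shows "qinf q holomorphic_on A"
proof -
  have "qinf q holomorphic_on ball 0 r" for r
  proof (rule holomorphic_uniform_sequence[OF open_ball])
    show "(\<lambda>u. \<Prod>j<n. 1 - u * q ^ j) holomorphic_on ball 0 r" for n
      by (intro holomorphic_intros)
    fix x :: complex assume "x \<in> ball 0 r"
    then obtain d where d: "d > 0" "cball x d \<subseteq> ball 0 r"
      using open_contains_cball open_ball by blast
    have "uniformly_convergent_on (cball x d) (\<lambda>N u. \<Prod>j<N. 1 - u * q ^ j)"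
    proof (rule uniformly_convergent_on_prod')
      show "uniformly_convergent_on (cball x d) (\<lambda>N u. \<Sum>j<N. norm (1 - u * q ^ j - 1))"
      proof (rule Weierstrass_m_test')
        show "summable (\<lambda>j. \<bar>r\<bar> * norm q ^ j)"
          using q by (intro summable_mult summable_geometric) auto
        show "norm (norm (1 - u * q ^ j - 1)) \<le> \<bar>r\<bar> * norm q ^ j" if "u \<in> cball x d" for j u
        proof -
          have "norm u \<le> \<bar>r\<bar>"
            using that d by force
          then show ?thesis
            by (simp add: norm_mult norm_power mult_right_mono)
        qed
      qed
    qed (auto intro!: continuous_intros)
    then have "uniform_limit (cball x d) (\<lambda>N u. \<Prod>j<N. 1 - u * q ^ j)
        (\<lambda>u. lim (\<lambda>N. \<Prod>j<N. 1 - u * q ^ j)) sequentially"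
      by (simp add: uniformly_convergent_uniform_limit_iff)
    moreover have "lim (\<lambda>N. \<Prod>j<N. 1 - u * q ^ j) = qinf q u" for u
      using convergent_prod_LIMSEQ[OF convergent_prod_qinf[OF q], of u]
      by (intro limI) (simp add: qinf_def LIMSEQ_lessThan_iff_atMost)
    ultimately show "\<exists>d>0. cball x d \<subseteq> ball 0 r \<and>
        uniform_limit (cball x d) (\<lambda>n u. \<Prod>j<n. 1 - u * q ^ j) (qinf q) sequentially"
      using d by auto
  qed
  then have "qinf q field_differentiable at u" for u
    using holomorphic_on_imp_differentiable_at[of "qinf q" "ball 0 (norm u + 1)" u] by auto
  then show ?thesis
    by (meson field_differentiable_at_within holomorphic_on_def)
qed

lemma qinf_compose_holomorphic [holomorphic_intros]:
  assumes "norm q < 1" "f holomorphic_on A"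
  shows "(\<lambda>z. qinf q (f z)) holomorphic_on A"
  using holomorphic_on_compose[OF assms(2) qinf_holomorphic[OF assms(1)]] by (simp add: o_def)

definition aw_Delta ::
  "complex \<Rightarrow> complex \<Rightarrow> complex \<Rightarrow> complex \<Rightarrow> complex \<Rightarrow> complex \<Rightarrow> complex" where
  "aw_Delta q a b c d z = qinf q (z\<^sup>2) / (qinf q (a * z) * qinf q (b * z) * qinf q (c * z) * qinf q (d * z))"

lemma aw_weight_eq:
  assumes "z \<noteq> 0"
  shows "aw_weight q a b c d z = aw_Delta q a b c d z * aw_Delta q a b c d (inverse z)"
  using assms
  by (simp add: aw_weight_def aw_Delta_def qpoch_inf_def qinf_def power_int_minus power_inverse)

text \<open>Replacing z by qz removes two factors from the product in z^2, because (qz)^2 = q^2 z^2,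
  and one factor from each product in the denominator. The points with e z = 1 have to be excluded:
  there the right side is a pole times a zero, which totalised division evaluates to 0.\<close>

lemma aw_Delta_rec:
  assumes q: "norm q < 1" and nz: "\<And>e. e \<in> {a, b, c, d} \<Longrightarrow> e * z \<noteq> 1"
  shows "aw_Delta q a b c d (q * z) * ((1 - z\<^sup>2) * (1 - q * z\<^sup>2)) =
    aw_Delta q a b c d z * ((1 - a * z) * (1 - b * z) * (1 - c * z) * (1 - d * z))"
proof -
  have Z: "qinf q (z\<^sup>2) = (1 - z\<^sup>2) * ((1 - q * z\<^sup>2) * qinf q ((q * z)\<^sup>2))"
    using qinf_rec[OF q, of "z\<^sup>2"] qinf_rec[OF q, of "z\<^sup>2 * q"]
    by (simp add: power2_eq_square mult_ac)
  have E: "qinf q (e * z) = (1 - e * z) * qinf q (e * (q * z))" for e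
    using qinf_rec[OF q, of "e * z"] by (simp add: mult_ac)
  have cancel: "Z / (A * B * C * D) * (s * t) = s * (t * Z) / (x * A * (y * B) * (u * C) * (v * D)) * (x * y * u * v)"
    if "x \<noteq> 0" "y \<noteq> 0" "u \<noteq> 0" "v \<noteq> 0" for Z A B C D s t x y u v :: complex
    using that by (simp add: mult_ac)
  show ?thesis
    unfolding aw_Delta_def Z E[of a] E[of b] E[of c] E[of d] by (rule cancel) (use nz in auto)
qed

section \<open>Symmetric Laurent polynomials\<close>

text \<open>Twice the Chebyshev polynomial of the first kind, so that it represents z^k + z^(-k),
  with value 2 at k = 0.\<close>

fun chebT :: "nat \<Rightarrow> complex poly" where
  "chebT 0 = [:2:]"
| "chebT (Suc 0) = [:0, 2:]"
| "chebT (Suc (Suc k)) = [:0, 2:] * chebT (Suc k) - chebT k"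

text \<open>The Chebyshev polynomial of the second kind with index lowered by one:
  \<open>chebU k\<close> is U_(k-1) and represents (z^k - z^(-k)) / (z - 1/z).\<close>

fun chebU :: "nat \<Rightarrow> complex poly" where
  "chebU 0 = 0"
| "chebU (Suc 0) = 1"
| "chebU (Suc (Suc k)) = [:0, 2:] * chebU (Suc k) - chebU k"

lemma laurent_of_poly_simps [simp]:
  "laurent_of_poly 0 z = 0"
  "laurent_of_poly 1 z = 1"
  "laurent_of_poly [:c:] z = c"
  "laurent_of_poly (p + r) z = laurent_of_poly p z + laurent_of_poly r z"
  "laurent_of_poly (p - r) z = laurent_of_poly p z - laurent_of_poly r z"
  "laurent_of_poly (- p) z = - laurent_of_poly p z"
  "laurent_of_poly (p * r) z = laurent_of_poly p z * laurent_of_poly r z"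
  "laurent_of_poly (smult c p) z = c * laurent_of_poly p z"
  "laurent_of_poly (sum f A) z = (\<Sum>x\<in>A. laurent_of_poly (f x) z)"
  by (simp_all add: laurent_of_poly_def poly_sum)

lemma laurent_of_poly_2X: "laurent_of_poly ([:0, 2:] * p) z = (z + inverse z) * laurent_of_poly p z"
  by (simp add: laurent_of_poly_def field_simps)

lemma laurent_chebT: "z \<noteq> 0 \<Longrightarrow> laurent_of_poly (chebT k) z = z ^ k + inverse z ^ k"
proof (induction k rule: chebT.induct)
  case (3 k)
  then show ?case
    unfolding chebT.simps laurent_of_poly_simps(5) laurent_of_poly_2X by (simp add: field_simps)
qed (simp_all add: laurent_of_poly_def)

lemma laurent_chebU: "z \<noteq> 0 \<Longrightarrow> laurent_of_poly (chebU k) z * (z - inverse z) = z ^ k - inverse z ^ k"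
proof (induction k rule: chebU.induct)
  case (3 k)
  have "laurent_of_poly (chebU (Suc (Suc k))) z * (z - inverse z) =
      (z + inverse z) * (laurent_of_poly (chebU (Suc k)) z * (z - inverse z))
      - laurent_of_poly (chebU k) z * (z - inverse z)"
    unfolding chebU.simps laurent_of_poly_simps(5) laurent_of_poly_2X by (simp only: left_diff_distrib mult.assoc)
  also have "\<dots> = z ^ Suc (Suc k) - inverse z ^ Suc (Suc k)"
    unfolding 3(1)[OF 3(3)] 3(2)[OF 3(3)] using 3(3) by (simp add: field_simps)
  finally show ?case .
qed auto

lemma coeff_chebT: "coeff (chebT k) k = (if k = 0 then 2 else 2 ^ k)"
  and coeff_chebT_above: "k < j \<Longrightarrow> coeff (chebT k) j = 0"
proof -
  have "coeff (chebT k) k = (if k = 0 then 2 else 2 ^ k) \<and> (\<forall>j>k. coeff (chebT k) j = 0)"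
    by (induction k rule: chebT.induct) (auto simp: coeff_pCons split: nat.splits)
  then show "coeff (chebT k) k = (if k = 0 then 2 else 2 ^ k)" "k < j \<Longrightarrow> coeff (chebT k) j = 0"
    by auto
qed

lemma coeff_chebU: "coeff (chebU (Suc k)) k = 2 ^ k"
  and coeff_chebU_above: "k \<le> j \<Longrightarrow> coeff (chebU k) j = 0"
proof -
  have "(k > 0 \<longrightarrow> coeff (chebU k) (k - 1) = 2 ^ (k - 1)) \<and> (\<forall>j\<ge>k. coeff (chebU k) j = 0)" for k
  proof (induction k rule: chebU.induct)
    case (3 k)
    then show ?case
      by (cases k) (auto simp: coeff_pCons split: nat.splits)
  qed (auto simp: coeff_pCons split: nat.splits)
  from this[of "Suc k"] this[of k] show "coeff (chebU (Suc k)) k = 2 ^ k" "k \<le> j \<Longrightarrow> coeff (chebU k) j = 0"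
    by auto
qed

text \<open>\<open>chebT k\<close> has degree exactly k, so leading terms can be removed one after
  the other. The second conclusion keeps hold of the top coefficient, from which the constants
  \<gamma>_n are later read off.\<close>

lemma poly_in_chebT_span:
  fixes p :: "complex poly"
  assumes "degree p \<le> n"
  obtains c where "p = (\<Sum>k\<le>n. smult (c k) (chebT k))" "coeff p n = c n * coeff (chebT n) n"
  using assms
proof (induction n arbitrary: p thesis)
  case 0
  then obtain a where "p = [:a:]"
    using degree_0_id[of p] by (metis le_zero_eq)
  then show ?case
    by (intro 0(1)[of "\<lambda>_. a / 2"]) auto
next
  case (Suc n)
  define l where "l = coeff p (Suc n) / 2 ^ Suc n"
  have "degree (p - smult l (chebT (Suc n))) \<le> n"
  proof (rule degree_le, intro allI impI)
    fix i assume "n < i"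
    then consider "i = Suc n" | "i > Suc n"
      by linarith
    then show "coeff (p - smult l (chebT (Suc n))) i = 0"
      using Suc(3) by cases (simp_all add: l_def coeff_chebT coeff_chebT_above coeff_eq_0)
  qed
  then obtain c where c: "p - smult l (chebT (Suc n)) = (\<Sum>k\<le>n. smult (c k) (chebT k))"
    using Suc.IH by blast
  have "(\<Sum>k\<le>n. smult (if k = Suc n then l else c k) (chebT k)) = (\<Sum>k\<le>n. smult (c k) (chebT k))"
    by (intro sum.cong) auto
  then have "p = (\<Sum>k\<le>Suc n. smult (if k = Suc n then l else c k) (chebT k))"
    using c by (simp add: algebra_simps)
  then show ?case
    by (rule Suc(2)) (simp add: l_def coeff_chebT)
qed

lemma sum_symmetric_int_interval:
  fixes g :: "int \<Rightarrow> 'a::comm_monoid_add"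
  shows "(\<Sum>k = - int n..int n. g k) = g 0 + (\<Sum>k=1..n. g (int k) + g (- int k))"
proof (induction n)
  case (Suc n)
  have "{- int (Suc n)..int (Suc n)} = insert (int (Suc n)) (insert (- int (Suc n)) {- int n..int n})"
    by auto
  then show ?case
    using Suc by (simp add: add_ac)
qed auto

text \<open>The factor \<open>2 ^ n\<close> arises because x^n = 2^(-n) (z + 1/z)^n has
  z^n-coefficient 2^(-n).\<close>

lemma sym_laurent_coeffs_iff_poly:
  "(\<exists>c. sym_laurent_coeffs n c f \<and> c (int n) = l) \<longleftrightarrow>
   (\<exists>p. degree p \<le> n \<and> coeff p n = 2 ^ n * l \<and> (\<forall>z. z \<noteq> 0 \<longrightarrow> f z = laurent_of_poly p z))"
proof
  assume "\<exists>c. sym_laurent_coeffs n c f \<and> c (int n) = l"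
  then obtain c where c: "\<And>k. c (- k) = c k" "c (int n) = l"
    "\<And>z. z \<noteq> 0 \<Longrightarrow> f z = (\<Sum>k = - int n..int n. c k * z powi k)"
    by (auto simp: sym_laurent_coeffs_def)
  define p where "p = [:c 0:] + (\<Sum>k=1..n. smult (c (int k)) (chebT k))"
  have "degree p \<le> n"
    unfolding p_def by (rule degree_le) (auto simp: coeff_sum coeff_chebT_above coeff_pCons split: nat.splits)
  moreover have "coeff p n = 2 ^ n * l"
  proof (cases n)
    case (Suc m)
    have "coeff p n = (\<Sum>k\<in>{1..n}. if k = n then c (int k) * 2 ^ n else 0)"
      unfolding p_def using Suc
      by (auto simp: coeff_sum coeff_chebT_above coeff_chebT coeff_pCons intro!: sum.cong)
    also have "\<dots> = c n * 2 ^ n"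
      using Suc by (subst sum.delta) auto
    finally show ?thesis
      using c(2) by simp
  qed (use c(2) in \<open>simp add: p_def\<close>)
  moreover have "f z = laurent_of_poly p z" if "z \<noteq> 0" for z
    using that c(1,3)
    by (simp add: sum_symmetric_int_interval p_def laurent_chebT power_int_minus power_inverse
        distrib_left)
  ultimately show "\<exists>p. degree p \<le> n \<and> coeff p n = 2 ^ n * l \<and> (\<forall>z. z \<noteq> 0 \<longrightarrow> f z = laurent_of_poly p z)"
    by blast
next
  assume "\<exists>p. degree p \<le> n \<and> coeff p n = 2 ^ n * l \<and> (\<forall>z. z \<noteq> 0 \<longrightarrow> f z = laurent_of_poly p z)"
  then obtain p where p: "degree p \<le> n" "coeff p n = 2 ^ n * l"
    "\<And>z. z \<noteq> 0 \<Longrightarrow> f z = laurent_of_poly p z"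
    by auto
  obtain c where c: "p = (\<Sum>k\<le>n. smult (c k) (chebT k))" "coeff p n = c n * coeff (chebT n) n"
    using poly_in_chebT_span[OF p(1)] by blast
  \<comment> \<open>The constant coefficient doubles because \<open>chebT 0\<close> is 2, whereas
    z^k and z^(-k) each occur once in \<open>chebT k\<close> for positive k.\<close>
  define c' where "c' k = (if k = 0 then 2 * c 0 else c (nat \<bar>k\<bar>))" for k :: int
  have "f z = (\<Sum>k = - int n..int n. c' k * z powi k)" if "z \<noteq> 0" for z
  proof -
    have "{..n} = insert 0 {1..n}"
      by auto
    then show ?thesis
      using that p(3)
      by (simp add: sum_symmetric_int_interval c(1) laurent_chebT power_int_minus power_inverse
          c'_def distrib_left mult_ac)
  qed
  moreover have "c' (int n) = l"
    using c(2) p(2) by (auto simp: coeff_chebT c'_def)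
  ultimately show "\<exists>c. sym_laurent_coeffs n c f \<and> c (int n) = l"
    by (intro exI[of _ c']) (auto simp: sym_laurent_coeffs_def c'_def)
qed

lemma sym_laurent_le_iff_poly:
  "sym_laurent_le n f \<longleftrightarrow> (\<exists>p. degree p \<le> n \<and> (\<forall>z. z \<noteq> 0 \<longrightarrow> f z = laurent_of_poly p z))"
proof -
  have "sym_laurent_le n f \<longleftrightarrow> (\<exists>l c. sym_laurent_coeffs n c f \<and> c (int n) = l)"
    by (auto simp: sym_laurent_le_def)
  also have "\<dots> \<longleftrightarrow> (\<exists>p. degree p \<le> n \<and> (\<forall>z. z \<noteq> 0 \<longrightarrow> f z = laurent_of_poly p z))"
    unfolding sym_laurent_coeffs_iff_poly
  proof safe
    fix p assume "degree p \<le> n" "\<forall>z. z \<noteq> 0 \<longrightarrow> f z = laurent_of_poly p z"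
    then show "\<exists>l p. degree p \<le> n \<and> coeff p n = 2 ^ n * l \<and>
        (\<forall>z. z \<noteq> 0 \<longrightarrow> f z = laurent_of_poly p z)"
      by (intro exI[of _ "coeff p n / 2 ^ n"] exI[of _ p]) auto
  qed auto
  finally show ?thesis .
qed

lemma sym_laurent_deg_iff_poly:
  "sym_laurent_deg n f \<longleftrightarrow>
   (\<exists>p. degree p \<le> n \<and> coeff p n \<noteq> 0 \<and> (\<forall>z. z \<noteq> 0 \<longrightarrow> f z = laurent_of_poly p z))"
proof -
  have "sym_laurent_deg n f \<longleftrightarrow> (\<exists>l. l \<noteq> 0 \<and> (\<exists>c. sym_laurent_coeffs n c f \<and> c (int n) = l))"
    by (auto simp: sym_laurent_deg_def)
  also have "\<dots> \<longleftrightarrow> (\<exists>p. degree p \<le> n \<and> coeff p n \<noteq> 0 \<and> (\<forall>z. z \<noteq> 0 \<longrightarrow> f z = laurent_of_poly p z))"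
    unfolding sym_laurent_coeffs_iff_poly
  proof safe
    fix p assume "degree p \<le> n" "coeff p n \<noteq> 0" "\<forall>z. z \<noteq> 0 \<longrightarrow> f z = laurent_of_poly p z"
    then show "\<exists>l. l \<noteq> 0 \<and> (\<exists>p. degree p \<le> n \<and> coeff p n = 2 ^ n * l \<and>
        (\<forall>z. z \<noteq> 0 \<longrightarrow> f z = laurent_of_poly p z))"
      by (intro exI[of _ "coeff p n / 2 ^ n"] conjI exI[of _ p]) auto
  qed auto
  finally show ?thesis .
qed

section \<open>The operator L on polynomials in x\<close>

definition aw_numerator ::
  "complex \<Rightarrow> complex \<Rightarrow> complex \<Rightarrow> complex \<Rightarrow> complex \<Rightarrow> (complex \<Rightarrow> complex) \<Rightarrow> complex \<Rightarrow> complex" where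
  "aw_numerator q a b c d f z =
     (1 - a * z) * (1 - b * z) * (1 - c * z) * (1 - d * z) * z powi (-2) * f (q * z)
      - (1 - a / z) * (1 - b / z) * (1 - c / z) * (1 - d / z) * z\<^sup>2 * f (inverse q * z)"

lemma aw_L_eq: "aw_L q a b c d f = remove_sings (\<lambda>z. aw_numerator q a b c d f z * inverse (z - inverse z))"
  by (simp add: aw_L_def aw_numerator_def)

text \<open>The odd extension to negative indices. Multiplying z^k + z^(-k) by a Laurent polynomial
  with exponents from -2 to 2 produces differences z^m - z^(-m) with m of either sign.\<close>

definition chebU' :: "int \<Rightarrow> complex poly" where
  "chebU' m = (if m \<ge> 0 then chebU (nat m) else - chebU (nat (- m)))"

lemma laurent_chebU': "z \<noteq> 0 \<Longrightarrow> laurent_of_poly (chebU' m) z * (z - inverse z) = z powi m - z powi (- m)"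
  using laurent_chebU[of z "nat m"] laurent_chebU[of z "nat (- m)"]
  by (auto simp: chebU'_def power_int_def)

lemma coeff_chebU':
  "\<bar>m\<bar> \<le> int n + 1 \<Longrightarrow> coeff (chebU' m) n = (if m = int n + 1 then 2 ^ n else if m = - int n - 1 then - (2 ^ n) else 0)"
  using coeff_chebU[of n] coeff_chebU_above[of "nat m" n] coeff_chebU_above[of "nat (-m)" n]
  by (auto simp: chebU'_def nat_add_distrib)

text \<open>Let P(z) be the sum of s_j z^j for j from -2 to 2, the coefficient of f[qz]. The
  numerator is P(z) f[qz] minus the same expression at 1/z, so for f = z^k + z^(-k) it is a sum of
  s_j q^k (z^(j+k) - z^(-j-k)) and s_j q^(-k) (z^(j-k) - z^(k-j)). Only the exponents k+2 and -k-2
  reach the top degree; they come from j = 2 and j = -2 and yield the two terms of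
  \<gamma>_k.\<close>

lemma aw_numerator_chebT:
  assumes q: "q \<noteq> 0"
  obtains r where "degree r \<le> k + 1"
    "coeff r (k + 1) = 2 * (a * b * c * d * q ^ k - inverse q ^ k) * coeff (chebT k) k"
    "\<And>z. z \<noteq> 0 \<Longrightarrow> aw_numerator q a b c d (laurent_of_poly (chebT k)) z = laurent_of_poly r z * (z - inverse z)"
proof -
  \<comment> \<open>\<open>s j\<close> is the coefficient of z^j in (1-az)(1-bz)(1-cz)(1-dz) z^(-2),
    a signed elementary symmetric polynomial in the parameters.\<close>
  define s where "s j = (if j = -2 then 1 else if j = -1 then - (a + b + c + d)
     else if j = 0 then a * b + a * c + a * d + b * c + b * d + c * d
     else if j = 1 then - (a * b * c + a * b * d + a * c * d + b * c * d) else a * b * c * d)" for j :: int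
  define r where "r = (\<Sum>j\<in>{-2, -1, 0, 1, 2}.
     smult (s j * q ^ k) (chebU' (j + int k)) + smult (s j * inverse q ^ k) (chebU' (j - int k)))"
  show ?thesis
  proof
    show "degree r \<le> k + 1"
      by (rule degree_le) (auto simp: r_def coeff_sum coeff_chebU')
    show "coeff r (k + 1) = 2 * (a * b * c * d * q ^ k - inverse q ^ k) * coeff (chebT k) k"
      by (auto simp: r_def coeff_sum coeff_chebU' coeff_chebT s_def algebra_simps)
    show "aw_numerator q a b c d (laurent_of_poly (chebT k)) z = laurent_of_poly r z * (z - inverse z)"
      if z: "z \<noteq> 0" for z
    proof -
      define w where "w = z ^ k"
      define Q where "Q = q ^ k"
      have nz: "w \<noteq> 0" "Q \<noteq> 0"
        using z q by (auto simp: w_def Q_def)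
      have V: "laurent_of_poly (chebU' (j + int k)) z * (z - inverse z) = z powi j * w - inverse (z powi j * w)"
        "laurent_of_poly (chebU' (j - int k)) z * (z - inverse z) = z powi j / w - w / z powi j" for j
        unfolding laurent_chebU'[OF z] using z
        by (simp_all add: power_int_add power_int_diff power_int_minus w_def divide_inverse mult_ac)
      define P where "P = (\<Sum>j\<in>{-2, -1, 0, 1, 2}. s j * z powi j)"
      define M where "M = (\<Sum>j\<in>{-2, -1, 0, 1, 2}. s j / z powi j)"
      have PM: "(1 - a * z) * (1 - b * z) * (1 - c * z) * (1 - d * z) * z powi (-2) = P"
        "(1 - a / z) * (1 - b / z) * (1 - c / z) * (1 - d / z) * z\<^sup>2 = M"
        using z by (simp_all add: P_def M_def s_def power_int_minus field_simps power2_eq_square)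
      have "laurent_of_poly r z * (z - inverse z) = (\<Sum>j\<in>{-2, -1, 0, 1, 2}.
         s j * Q * (z powi j * w - inverse (z powi j * w)) + s j * inverse Q * (z powi j / w - w / z powi j))"
        unfolding V[symmetric] r_def
        by (simp only: laurent_of_poly_simps sum_distrib_right Q_def power_inverse distrib_right mult.assoc)
      also have "\<dots> = P * (Q * w + inverse (Q * w)) - M * (w / Q + Q / w)"
        by (simp add: P_def M_def algebra_simps divide_inverse)
      also have "\<dots> = aw_numerator q a b c d (laurent_of_poly (chebT k)) z"
        unfolding aw_numerator_def PM using z q
        by (simp add: laurent_chebT power_mult_distrib power_inverse w_def Q_def
            divide_inverse mult.commute)
      finally show ?thesis ..
    qed
  qed
qed

lemma aw_numerator_sum:
  "aw_numerator q a b c d (laurent_of_poly (\<Sum>k\<in>A. smult (l k) (p k))) z =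
    (\<Sum>k\<in>A. l k * aw_numerator q a b c d (laurent_of_poly (p k)) z)"
proof -
  have "X * (\<Sum>k\<in>A. l k * u k) - Y * (\<Sum>k\<in>A. l k * v k) = (\<Sum>k\<in>A. l k * (X * u k - Y * v k))"
    for X Y and u v :: "'a \<Rightarrow> complex"
    by (simp add: sum_distrib_left right_diff_distrib sum_subtractf mult_ac)
  then show ?thesis
    by (simp add: aw_numerator_def)
qed

lemma aw_numerator_cong:
  assumes "q \<noteq> 0" "z \<noteq> 0" "\<And>z. z \<noteq> 0 \<Longrightarrow> f z = g z"
  shows "aw_numerator q a b c d f z = aw_numerator q a b c d g z"
  using assms by (simp add: aw_numerator_def)

lemma aw_numerator_poly:
  assumes q: "q \<noteq> 0" and p: "degree p \<le> n"
  obtains r where "degree r \<le> n + 1"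
    "coeff r (n + 1) = 2 * (a * b * c * d * q ^ n - inverse q ^ n) * coeff p n"
    "\<And>z. z \<noteq> 0 \<Longrightarrow> aw_numerator q a b c d (laurent_of_poly p) z = laurent_of_poly r z * (z - inverse z)"
proof -
  obtain l where l: "p = (\<Sum>k\<le>n. smult (l k) (chebT k))" "coeff p n = l n * coeff (chebT n) n"
    using poly_in_chebT_span[OF p] by blast
  have "\<forall>k. \<exists>r. degree r \<le> k + 1 \<and>
    coeff r (k + 1) = 2 * (a * b * c * d * q ^ k - inverse q ^ k) * coeff (chebT k) k \<and>
    (\<forall>z. z \<noteq> 0 \<longrightarrow> aw_numerator q a b c d (laurent_of_poly (chebT k)) z = laurent_of_poly r z * (z - inverse z))"
    using aw_numerator_chebT[OF q] by metis
  then obtain R where R: "\<And>k. degree (R k) \<le> k + 1"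
    "\<And>k. coeff (R k) (k + 1) = 2 * (a * b * c * d * q ^ k - inverse q ^ k) * coeff (chebT k) k"
    "\<And>k z. z \<noteq> 0 \<Longrightarrow> aw_numerator q a b c d (laurent_of_poly (chebT k)) z = laurent_of_poly (R k) z * (z - inverse z)"
    by metis
  define r where "r = (\<Sum>k\<le>n. smult (l k) (R k))"
  show ?thesis
  proof
    show "degree r \<le> n + 1"
      unfolding r_def
      by (intro degree_sum_le) (auto intro!: order.trans[OF degree_smult_le] order.trans[OF R(1)])
    have "coeff (R k) (n + 1) = 0" if "k < n" for k
      using that R(1)[of k] by (intro coeff_eq_0) auto
    then have "coeff r (n + 1) = (\<Sum>k\<le>n. if k = n then l n * coeff (R n) (n + 1) else 0)"
      unfolding r_def coeff_sum by (intro sum.cong) auto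
    then show "coeff r (n + 1) = 2 * (a * b * c * d * q ^ n - inverse q ^ n) * coeff p n"
      using R(2)[of n] by (simp add: l(2))
    show "aw_numerator q a b c d (laurent_of_poly p) z = laurent_of_poly r z * (z - inverse z)" if "z \<noteq> 0" for z
      unfolding l(1) aw_numerator_sum using that by (simp add: R(3) r_def sum_distrib_right mult.assoc)
  qed
qed

lemma continuous_laurent_of_poly: "z \<noteq> 0 \<Longrightarrow> isCont (laurent_of_poly p) z"
  unfolding laurent_of_poly_def by (intro continuous_intros) auto

lemma eventually_at_sq_neq_1: "\<forall>\<^sub>F w in at (z::complex). w \<noteq> 0 \<and> w\<^sup>2 \<noteq> 1"
proof -
  have "\<forall>\<^sub>F w in at z. w \<noteq> 0 \<and> w \<noteq> 1 \<and> w \<noteq> -1"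
    by (intro eventually_conj eventually_neq_at_within)
  then show ?thesis
    by eventually_elim (auto simp: power2_eq_1_iff)
qed

lemma minus_inverse_nonzero: "z \<noteq> 0 \<Longrightarrow> z\<^sup>2 \<noteq> 1 \<Longrightarrow> z - inverse z \<noteq> (0::complex)"
  by (auto simp: field_simps power2_eq_square)

text \<open>\<open>remove_sings\<close> takes the limit at \<open>z\<close>, which depends only on
  nearby points; these can be chosen with w^2 different from 1. A continuous candidate that is
  correct there is therefore correct also at z = 1 and z = -1.\<close>

lemma aw_L_eqI:
  assumes z: "z \<noteq> 0" and g: "isCont g z"
    and num: "\<And>w. w \<noteq> 0 \<Longrightarrow> w\<^sup>2 \<noteq> 1 \<Longrightarrow> aw_numerator q a b c d f w = (w - inverse w) * g w"
  shows "aw_L q a b c d f z = g z"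
  unfolding aw_L_eq
proof (rule remove_sings_eqI)
  have "\<forall>\<^sub>F w in at z. g w = aw_numerator q a b c d f w * inverse (w - inverse w)"
    using eventually_at_sq_neq_1[of z]
    by eventually_elim (use num minus_inverse_nonzero in simp)
  with g[unfolded isCont_def] show "(\<lambda>z. aw_numerator q a b c d f z * inverse (z - inverse z)) \<midarrow>z\<rightarrow> g z"
    by (rule Lim_transform_eventually)
qed

lemma aw_L_poly:
  assumes q: "q \<noteq> 0" and p: "degree p \<le> n" and f: "\<And>z. z \<noteq> 0 \<Longrightarrow> f z = laurent_of_poly p z"
  obtains r where "degree r \<le> n + 1"
    "coeff r (n + 1) = 2 * (a * b * c * d * q ^ n - inverse q ^ n) * coeff p n"
    "\<And>z. z \<noteq> 0 \<Longrightarrow> aw_L q a b c d f z = laurent_of_poly r z"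
proof -
  obtain r where r: "degree r \<le> n + 1"
    "coeff r (n + 1) = 2 * (a * b * c * d * q ^ n - inverse q ^ n) * coeff p n"
    "\<And>z. z \<noteq> 0 \<Longrightarrow> aw_numerator q a b c d (laurent_of_poly p) z = laurent_of_poly r z * (z - inverse z)"
    using aw_numerator_poly[OF q p] by blast
  have "aw_L q a b c d f z = laurent_of_poly r z" if z: "z \<noteq> 0" for z
    using aw_numerator_cong[OF q _ f] r(3)
    by (intro aw_L_eqI z continuous_laurent_of_poly) (simp add: mult.commute)
  with r that show ?thesis
    by blast
qed

lemma aw_L_generic:
  assumes q: "q \<noteq> 0" and f: "sym_laurent f" and z: "z \<noteq> 0" "z\<^sup>2 \<noteq> 1"
  shows "aw_L q a b c d f z = aw_numerator q a b c d f z / (z - inverse z)"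
proof -
  obtain p where p: "\<And>z. z \<noteq> 0 \<Longrightarrow> f z = laurent_of_poly p z"
    using f by (auto simp: sym_laurent_def sym_laurent_le_iff_poly)
  have "aw_L q a b c d f z = aw_numerator q a b c d (laurent_of_poly p) z / (z - inverse z)"
  proof (rule aw_L_eqI[OF z(1)])
    show "isCont (\<lambda>z. aw_numerator q a b c d (laurent_of_poly p) z / (z - inverse z)) z"
      unfolding aw_numerator_def laurent_of_poly_def using z q minus_inverse_nonzero[OF z]
      by (intro continuous_intros) auto
  qed (use aw_numerator_cong[OF q _ p] minus_inverse_nonzero in simp)
  then show ?thesis
    using aw_numerator_cong[OF q z(1) p] by simp
qed

section \<open>Skew symmetry\<close>

text \<open>The possible poles of \<Delta>(1/z) together with their limit 0, which makes the set
  compact. The possible poles of \<Delta>(z) are the inverses of its nonzero elements.\<close>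

definition aw_poles :: "complex \<Rightarrow> complex set \<Rightarrow> complex set" where
  "aw_poles q E = insert 0 (\<Union>e\<in>E. range (\<lambda>k::nat. e * q ^ k))"

lemma aw_poles_iff: "w \<in> aw_poles q E \<longleftrightarrow> w = 0 \<or> (\<exists>e\<in>E. \<exists>k. w = e * q ^ k)"
  by (auto simp: aw_poles_def)

lemma tendsto_geometric_mult:
  fixes q :: complex
  assumes "norm q < 1"
  shows "(\<lambda>k. e * q ^ k) \<longlonglongrightarrow> 0"
  using tendsto_mult_right_zero[OF LIMSEQ_power_zero[OF assms]] .

lemma compact_aw_poles:
  assumes "norm q < 1" "finite E"
  shows "compact (aw_poles q E)"
proof -
  have "aw_poles q E = {0} \<union> (\<Union>e\<in>E. insert 0 (range (\<lambda>k. e * q ^ k)))"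
    by (auto simp: aw_poles_def)
  also have "compact \<dots>"
    using assms by (intro compact_Un compact_UN compact_sequence_with_limit tendsto_geometric_mult) auto
  finally show ?thesis .
qed

lemma countable_aw_poles: "countable E \<Longrightarrow> countable (aw_poles q E)"
  by (auto simp: aw_poles_def)

lemma finite_aw_poles_outside:
  assumes "norm q < 1" "finite E" "r > 0"
  shows "finite (aw_poles q E - ball 0 r)"
proof -
  have "finite (range (\<lambda>k. e * q ^ k) - ball 0 r)" for e
  proof -
    have "\<forall>\<^sub>F k in sequentially. dist (e * q ^ k) 0 < r"
      using tendsto_geometric_mult[OF assms(1)] assms(3) by (rule tendstoD)
    then obtain N where N: "\<And>k. k \<ge> N \<Longrightarrow> dist (e * q ^ k) 0 < r"
      by (auto simp: eventually_sequentially)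
    have "range (\<lambda>k. e * q ^ k) - ball 0 r \<subseteq> (\<lambda>k. e * q ^ k) ` {..<N}"
      using N by (force simp: not_le[symmetric] dist_commute)
    then show ?thesis
      by (rule finite_subset) auto
  qed
  then have "finite (\<Union>e\<in>E. range (\<lambda>k. e * q ^ k) - ball 0 r)"
    using assms(2) by blast
  then show ?thesis
    using assms(3) by (rule_tac finite_subset[of _ "(\<Union>e\<in>E. range (\<lambda>k. e * q ^ k) - ball 0 r)"])
      (auto simp: aw_poles_def)
qed

text \<open>A point e q^k coincides with a point 1/(f q^l) exactly if e f q^(k+l) = 1. The
  conditions on the products of two parameters, squares included, thus say that the sequences to be
  separated are disjoint.\<close>

lemma aw_contour_exists:
  assumes q: "norm q < 1" "q \<noteq> 0" and params: "\<And>e f n. e \<in> {a, b, c, d} \<Longrightarrow> f \<in> {a, b, c, d} \<Longrightarrow> e * f * q ^ n \<noteq> 1"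
  shows "\<exists>C. aw_contour q a b c d C"
proof -
  define E where "E = {a, b, c, d}"
  define K where "K = aw_poles q E"
  have mem: "e * q ^ k \<in> K" if "e \<in> E" for e k
    using that by (auto simp: K_def aw_poles_iff)
  have disj: "K \<inter> inverse ` (K - {0}) = {}"
  proof (rule ccontr)
    assume "K \<inter> inverse ` (K - {0}) \<noteq> {}"
    then obtain v w where vw: "v \<in> K" "w \<in> K" "w \<noteq> 0" "v = inverse w"
      by auto
    then have "v \<noteq> 0"
      by simp
    with vw obtain e k f l where "e \<in> E" "f \<in> E" "v = e * q ^ k" "w = f * q ^ l"
      unfolding K_def aw_poles_iff by metis
    moreover have "v * w = 1"
      using vw by simp
    ultimately show False
      using params[of e f "k + l"] by (simp add: E_def power_add mult_ac)
  qed
  obtain C where C: "valid_path C" "pathfinish C = pathstart C" "path_image C \<inter> (K \<union> inverse ` K) = {}"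
    "\<And>w. w \<in> K \<Longrightarrow> winding_number C w = 1"
    "\<And>w. w \<in> inverse ` (K - {0}) \<Longrightarrow> winding_number C w = 0"
  proof (rule separating_loop_exists[of K])
    show "compact K" "0 \<in> K" "K \<inter> inverse ` (K - {0}) = {}"
      using disj q by (auto simp: K_def E_def compact_aw_poles aw_poles_iff)
    show "finite (K - ball 0 r)" if "r > 0" for r
      using that q by (simp add: K_def E_def finite_aw_poles_outside)
    fix C assume "valid_path C" "pathfinish C = pathstart C" "path_image C \<inter> (K \<union> inverse ` K) = {}"
      "\<And>w. w \<in> K \<Longrightarrow> winding_number C w = 1"
      "\<And>w. w \<in> inverse ` (K - {0}) \<Longrightarrow> winding_number C w = 0"
    then show thesis
      by (rule that)
  qed
  have "aw_contour q a b c d C"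
    unfolding aw_contour_def E_def[symmetric]
  proof (intro conjI ballI allI impI)
    have "0 \<in> K"
      by (simp add: K_def aw_poles_iff)
    then show "0 \<notin> path_image C" "winding_number C 0 = 1"
      using C(3,4) by auto
    fix e k assume e: "e \<in> E"
    show "e * q ^ k \<notin> path_image C" "winding_number C (e * q ^ k) = 1"
      using C(3,4) mem[OF e, of k] by auto
    assume "e \<noteq> 0"
    show "inverse (e * q ^ k) \<notin> path_image C"
      using C(3) mem[OF e, of k] by blast
    have "e * q ^ k \<noteq> 0"
      using \<open>e \<noteq> 0\<close> q by simp
    then show "winding_number C (inverse (e * q ^ k)) = 0"
      using C(5) mem[OF e, of k] by blast
  qed (use C in auto)
  then show ?thesis
    by blast
qed

section \<open>Moving the contour from C to C/q\<close>

lemma winding_number_scale: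
  assumes "valid_path C" "w \<notin> path_image C" "s \<noteq> 0"
  shows "winding_number ((*) s \<circ> C) (s * w) = winding_number C w"
proof -
  have vp: "valid_path ((*) s \<circ> C)"
    by (rule valid_path_compose_holomorphic[OF assms(1), of _ UNIV]) (auto intro!: holomorphic_intros)
  have "s * w \<notin> path_image ((*) s \<circ> C)"
    using assms(2,3) by (auto simp: path_image_compose)
  then have "winding_number ((*) s \<circ> C) (s * w) =
      1 / (2 * pi * \<i>) * contour_integral ((*) s \<circ> C) (\<lambda>v. 1 / (v - s * w))"
    by (rule winding_number_valid_path[OF vp])
  also have "contour_integral ((*) s \<circ> C) (\<lambda>v. 1 / (v - s * w)) =
      contour_integral C (\<lambda>v. deriv ((*) s) v * (1 / (s * v - s * w)))"
    by (rule contour_integral_comp_analyticW[where s = UNIV]) (use assms in \<open>auto intro!: analytic_intros\<close>)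
  also have "(\<lambda>v. deriv ((*) s) v * (1 / (s * v - s * w))) = (\<lambda>v. 1 / (v - w))"
    using assms(3) by (auto simp: fun_eq_iff right_diff_distrib[symmetric])
  also have "1 / (2 * pi * \<i>) * contour_integral C \<dots> = winding_number C w"
    using winding_number_valid_path[OF assms(1,2)] by simp
  finally show ?thesis .
qed

text \<open>With \<open>F(f,g)\<close> the function defined here, the integrand of \<open>\<langle>Lf,g\<rangle>\<close> is
  \<open>F(g,f)(z/q)/q - F(f,g)(z)\<close>. This is because \<open>\<Delta>(qz)\<close> and \<open>\<Delta>(z)\<close> differ by exactly the
  polynomial factors in the coefficients of \<open>L\<close>.\<close>

definition aw_shift_integrand ::
  "complex \<Rightarrow> complex \<Rightarrow> complex \<Rightarrow> complex \<Rightarrow> complex \<Rightarrow>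
   (complex \<Rightarrow> complex) \<Rightarrow> (complex \<Rightarrow> complex) \<Rightarrow> complex \<Rightarrow> complex" where
  "aw_shift_integrand q a b c d f g z =
     f (q * z) * g z * aw_Delta q a b c d (q * z) * aw_Delta q a b c d (inverse z)
     * (inverse z - q * z) / z"

lemma aw_integrand_split:
  assumes q: "norm q < 1" "q \<noteq> 0" and f: "sym_laurent f" and z: "z \<noteq> 0"
    and nz: "\<And>e. e \<in> {a, b, c, d} \<Longrightarrow> e * z \<noteq> 1" "\<And>e. e \<in> {a, b, c, d} \<Longrightarrow> e \<noteq> z"
  shows "aw_L q a b c d f z * g z * aw_weight q a b c d z / z =
    aw_shift_integrand q a b c d g f (inverse q * z) * inverse q - aw_shift_integrand q a b c d f g z"
proof (cases "z\<^sup>2 = 1")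
  \<comment> \<open>At z = 1 and z = -1 the value of Lf is a filled-in limit. It is irrelevant,
    since \<Delta>(z) = \<Delta>(1/z) contains the factor (1;q) and vanishes, which makes both sides
    0.\<close>
  case True
  then have "inverse z = z"
    using z by (simp add: field_simps power2_eq_square)
  moreover have "aw_Delta q a b c d z = 0"
    using True q by (simp add: aw_Delta_def qinf_1)
  ultimately show ?thesis
    using z q by (simp add: aw_weight_eq aw_shift_integrand_def mult.assoc[symmetric])
next
  case False
  define D D' Dq Dq' where "D = aw_Delta q a b c d z" and "D' = aw_Delta q a b c d (inverse z)"
    and "Dq = aw_Delta q a b c d (q * z)" and "Dq' = aw_Delta q a b c d (q * inverse z)"
  define A A' where "A = (1 - a * z) * (1 - b * z) * (1 - c * z) * (1 - d * z)"
    and "A' = (1 - a / z) * (1 - b / z) * (1 - c / z) * (1 - d / z)"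
  have nz': "z - inverse z \<noteq> 0"
    by (rule minus_inverse_nonzero[OF z False])
  have 1: "D * A = Dq * ((1 - z\<^sup>2) * (1 - q * z\<^sup>2))"
    using aw_Delta_rec[OF q(1) nz(1)] by (simp add: D_def A_def Dq_def)
  have 2: "D' * A' = Dq' * ((1 - (inverse z)\<^sup>2) * (1 - q * (inverse z)\<^sup>2))"
  proof -
    have "e * inverse z \<noteq> 1" if "e \<in> {a, b, c, d}" for e
      using nz(2)[OF that] z by (simp add: field_simps)
    from aw_Delta_rec[OF q(1) this] show ?thesis
      by (simp add: D'_def A'_def Dq'_def divide_inverse)
  qed
  have "aw_L q a b c d f z * g z * aw_weight q a b c d z / z =
      (A * z powi (-2) * f (q * z) - A' * z\<^sup>2 * f (inverse q * z)) / (z - inverse z) * g z * (D * D') / z"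
    using aw_L_generic[OF q(2) f z False]
    by (simp add: aw_numerator_def A_def A'_def aw_weight_eq[OF z] D_def D'_def)
  also have "\<dots> = ((D * A) * (inverse z)\<^sup>2 * f (q * z) * D' - (D' * A') * z\<^sup>2 * f (inverse q * z) * D)
      / (z - inverse z) * g z / z"
    by (simp add: power_int_minus power_inverse algebra_simps)
  also have "\<dots> = Dq * D' * f (q * z) * g z / z * ((1 - z\<^sup>2) * (inverse z)\<^sup>2 / (z - inverse z)) * (1 - q * z\<^sup>2)
      - Dq' * D * f (inverse q * z) * g z / z * ((1 - (inverse z)\<^sup>2) * z\<^sup>2 / (z - inverse z)) * (1 - q * (inverse z)\<^sup>2)"
    unfolding 1 2 by (simp add: diff_divide_distrib left_diff_distrib right_diff_distrib mult_ac)
  \<comment> \<open>Of the two factors in the recursion for \<Delta>, 1 - z^2 cancels the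
    denominator z - 1/z, and 1 - q z^2 becomes the factor 1/z - qz of the shifted integrand.\<close>
  also have "(1 - z\<^sup>2) * (inverse z)\<^sup>2 / (z - inverse z) = - inverse z"
    using z nz' by (simp add: divide_eq_eq) (simp add: field_simps power2_eq_square)
  also have "(1 - (inverse z)\<^sup>2) * z\<^sup>2 / (z - inverse z) = z"
    using z nz' by (simp add: divide_eq_eq) (simp add: field_simps power2_eq_square)
  also have "Dq * D' * f (q * z) * g z / z * - inverse z * (1 - q * z\<^sup>2)
      - Dq' * D * f (inverse q * z) * g z / z * z * (1 - q * (inverse z)\<^sup>2)
      = aw_shift_integrand q a b c d g f (inverse q * z) * inverse q - aw_shift_integrand q a b c d f g z"
    using z q by (simp add: aw_shift_integrand_def D_def D'_def Dq_def Dq'_def mult.assoc[symmetric])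
      (simp add: field_simps power2_eq_square)
  finally show ?thesis .
qed

lemma laurent_of_poly_holomorphic [holomorphic_intros]:
  assumes "f holomorphic_on A" "\<And>z. z \<in> A \<Longrightarrow> f z \<noteq> 0"
  shows "(\<lambda>z. laurent_of_poly p (f z)) holomorphic_on A"
proof -
  have "poly p holomorphic_on B" for B
    by (simp add: holomorphic_on_def field_differentiable_def) (meson DERIV_subset poly_DERIV subset_UNIV)
  moreover have "(\<lambda>z. (f z + inverse (f z)) / 2) holomorphic_on A"
    using assms by (intro holomorphic_intros) auto
  ultimately show ?thesis
    unfolding laurent_of_poly_def
    using holomorphic_on_compose[of "\<lambda>z. (f z + inverse (f z)) / 2" A "poly p"] by (simp add: o_def)
qed

lemma aw_Delta_holomorphic [holomorphic_intros]:
  assumes "norm q < 1" "f holomorphic_on A" "\<And>z e k. z \<in> A \<Longrightarrow> e \<in> {a, b, c, d} \<Longrightarrow> e * f z * q ^ k \<noteq> 1"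
  shows "(\<lambda>z. aw_Delta q a b c d (f z)) holomorphic_on A"
proof -
  have "qinf q (e * f z) \<noteq> 0" if "z \<in> A" "e \<in> {a, b, c, d}" for e z
    using that assms by (intro qinf_nonzero) auto
  then show ?thesis
    unfolding aw_Delta_def using assms(1,2) by (intro holomorphic_intros) simp_all
qed

text \<open>The winding number of \<open>C/q\<close> around \<open>w\<close> is that of \<open>C\<close> around \<open>q w\<close>. Multiplication by \<open>q\<close>
  moves the pole \<open>e q\<^sup>k\<close> of \<open>\<Delta>(1/z)\<close> to \<open>e q\<^bsup>k+1\<^esup>\<close>, which \<open>C\<close> encircles as well, and the pole
  \<open>1/(e q\<^bsup>k+1\<^esup>)\<close> of \<open>\<Delta>(qz)\<close> to \<open>1/(e q\<^sup>k)\<close>, which it does not encircle. The point \<open>1/e\<close> is not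
  a pole of \<open>\<Delta>(qz)\<close>.\<close>

lemma aw_shift_integral:
  assumes q: "norm q < 1" "q \<noteq> 0" and C: "aw_contour q a b c d C"
    and f: "\<And>z. z \<noteq> 0 \<Longrightarrow> f z = laurent_of_poly p z" and g: "\<And>z. z \<noteq> 0 \<Longrightarrow> g z = laurent_of_poly r z"
  shows "aw_shift_integrand q a b c d f g contour_integrable_on C"
    and "(\<lambda>z. aw_shift_integrand q a b c d f g (inverse q * z) * inverse q) contour_integrable_on C"
    and "contour_integral C (\<lambda>z. aw_shift_integrand q a b c d f g (inverse q * z) * inverse q) =
      contour_integral C (aw_shift_integrand q a b c d f g)"
proof -
  let ?F = "aw_shift_integrand q a b c d f g"
  define E where "E = {a, b, c, d}"
  define K where "K = aw_poles q E"
  define K' where "K' = (*) q ` K"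
  define S where "S = - (K \<union> inverse ` K')"
  have S_iff: "z \<in> S \<longleftrightarrow> z \<noteq> 0 \<and> (\<forall>e\<in>E. \<forall>k. z \<noteq> e * q ^ k \<and> z \<noteq> inverse (e * q ^ Suc k))" for z
  proof -
    have "z \<in> inverse ` K' \<longleftrightarrow> z = 0 \<or> (\<exists>e\<in>E. \<exists>k. z = inverse (e * q ^ Suc k))"
    proof -
      have "z \<in> inverse ` K' \<longleftrightarrow> (\<exists>w. (w = 0 \<or> (\<exists>e\<in>E. \<exists>k. w = e * q ^ k)) \<and> z = inverse (q * w))"
        unfolding K'_def K_def image_image image_iff Bex_def aw_poles_iff ..
      also have "\<dots> \<longleftrightarrow> z = 0 \<or> (\<exists>e\<in>E. \<exists>k. z = inverse (e * q ^ Suc k))"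
      proof -
        have *: "q * (e * q ^ k) = e * q ^ Suc k" for e k
          by simp
        have "(\<exists>w. (w = 0 \<or> (\<exists>e\<in>E. \<exists>k. w = e * q ^ k)) \<and> z = inverse (q * w)) \<longleftrightarrow>
          z = inverse (q * 0) \<or> (\<exists>e\<in>E. \<exists>k. z = inverse (q * (e * q ^ k)))"
          by blast
        then show ?thesis
          unfolding * by simp
      qed
      finally show ?thesis .
    qed
    then show ?thesis
      by (auto simp: S_def K_def aw_poles_iff)
  qed
  have compact: "compact K" "compact K'"
    using q by (auto simp: K_def K'_def E_def compact_aw_poles intro!: compact_continuous_image continuous_intros)
  have S: "open S" "connected S"
  proof -
    have "closed (K \<union> inverse ` K')"
      using compact by (intro closed_Un_inverse_image) (auto simp: compact_imp_closed K_def aw_poles_iff)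
    then show "open S"
      unfolding S_def by (rule open_Compl)
    have "countable (K \<union> inverse ` K')"
      by (auto simp: K_def K'_def E_def countable_aw_poles)
    then show "connected S"
      unfolding S_def by (intro path_connected_imp_connected path_connected_complement_countable) auto
  qed
  have C': "valid_path C" "pathfinish C = pathstart C" "0 \<notin> path_image C" "winding_number C 0 = 1"
    and pole_in: "\<And>e k. e \<in> E \<Longrightarrow> e * q ^ k \<notin> path_image C \<and> winding_number C (e * q ^ k) = 1"
    and pole_out: "\<And>e k. e \<in> E \<Longrightarrow> e \<noteq> 0 \<Longrightarrow>
      inverse (e * q ^ k) \<notin> path_image C \<and> winding_number C (inverse (e * q ^ k)) = 0"
    using C unfolding aw_contour_def E_def[symmetric] by simp_all
  \<comment> \<open>For e = 0 the inverse is 0 by convention, and C avoids 0 as well.\<close>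
  have avoid_out: "inverse (e * q ^ k) \<notin> path_image C" if "e \<in> E" for e k
    using pole_out[OF that, of k] C'(3) by (cases "e = 0") auto
  have CS: "path_image C \<subseteq> S"
    unfolding subset_iff S_iff using C'(3) pole_in avoid_out by metis
  \<comment> \<open>\<open>C2\<close> is C/q. The substitution v = z/q turns the integral of
    F(z/q)/q over C into that of F over \<open>C2\<close>.\<close>
  define C2 where "C2 = (*) (inverse q) \<circ> C"
  have C2: "valid_path C2" "pathfinish C2 = pathstart C2"
    unfolding C2_def
    using C' valid_path_compose_holomorphic[OF C'(1), of "(*) (inverse q)" UNIV]
    by (auto intro!: holomorphic_intros simp: pathfinish_compose pathstart_compose)
  have scale_S: "inverse q * z \<in> S" if "z \<in> path_image C" for z
  proof -
    have "inverse q * z \<noteq> e * q ^ k" if "e \<in> E" for e k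
      using pole_in[OF that, of "Suc k"] \<open>z \<in> path_image C\<close> q by (auto simp: field_simps)
    moreover have "inverse q * z \<noteq> inverse (e * q ^ Suc k)" if "e \<in> E" for e k
      using avoid_out[OF that, of k] \<open>z \<in> path_image C\<close> q by (auto simp: field_simps)
    ultimately show ?thesis
      using C'(3) that q by (auto simp: S_iff)
  qed
  then have C2S: "path_image C2 \<subseteq> S"
    by (auto simp: C2_def path_image_compose)
  have F: "?F holomorphic_on S"
  proof -
    have "(\<lambda>z. laurent_of_poly p (q * z) * laurent_of_poly r z * aw_Delta q a b c d (q * z)
        * aw_Delta q a b c d (inverse z) * (inverse z - q * z) / z) holomorphic_on S"
    proof (intro holomorphic_intros, unfold E_def[symmetric])
      fix z e k assume z: "z \<in> S" and e: "e \<in> E"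
      show "e * (q * z) * q ^ k \<noteq> 1"
      proof
        assume "e * (q * z) * q ^ k = 1"
        then have "z = inverse (e * q ^ Suc k)"
          by (intro inverse_unique[symmetric]) (simp add: mult_ac)
        with z e show False
          by (auto simp: S_iff)
      qed
      show "e * inverse z * q ^ k \<noteq> 1"
        using z e by (auto simp: S_iff field_simps)
    qed (use q in \<open>auto simp: S_iff\<close>)
    then show ?thesis
      by (rule holomorphic_transform) (use f g q in \<open>auto simp: aw_shift_integrand_def S_iff\<close>)
  qed
  show "?F contour_integrable_on C"
    using F S C' CS by (intro contour_integrable_holomorphic_simple)
  have scale: "open ((*) (inverse q) -` S)"
    by (intro open_vimage S continuous_intros)
  have "(\<lambda>z. ?F (inverse q * z) * inverse q) holomorphic_on ((*) (inverse q) -` S)"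
    by (intro holomorphic_intros holomorphic_on_compose_gen[OF _ F, unfolded o_def]) auto
  then show "(\<lambda>z. ?F (inverse q * z) * inverse q) contour_integrable_on C"
    using scale C' scale_S by (intro contour_integrable_holomorphic_simple) auto
  have "contour_integral C2 ?F = contour_integral C (\<lambda>z. deriv ((*) (inverse q)) z * ?F (inverse q * z))"
    unfolding C2_def
    by (rule contour_integral_comp_analyticW[where s = UNIV]) (use C' in \<open>auto intro!: analytic_intros\<close>)
  also have "(\<lambda>z. deriv ((*) (inverse q)) z * ?F (inverse q * z)) = (\<lambda>z. ?F (inverse q * z) * inverse q)"
    by (auto simp: fun_eq_iff)
  finally have "contour_integral C (\<lambda>z. ?F (inverse q * z) * inverse q) = contour_integral C2 ?F" ..
  also have "\<dots> = contour_integral C ?F"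
  proof (rule contour_integral_eq_homologous_loops[OF S C2 C2S C'(1,2) CS _ F])
    fix w assume "w \<notin> S"
    then consider "w = 0" | e k where "e \<in> E" "w = e * q ^ k"
      | e k where "e \<in> E" "e \<noteq> 0" "w = inverse (e * q ^ Suc k)"
      unfolding S_iff by (metis inverse_zero mult_zero_left)
    then have "q * w \<notin> path_image C \<and> winding_number C (q * w) = winding_number C w"
    proof cases
      case 1
      then show ?thesis
        using C' by simp
    next
      case (2 e k)
      then have "q * w = e * q ^ Suc k"
        by simp
      with 2 show ?thesis
        using pole_in by metis
    next
      case (3 e k)
      then have "q * w = inverse (e * q ^ k)"
        using q by simp
      with 3 show ?thesis
        using pole_out by metis
    qed
    moreover have "inverse q * (q * w) = w"
      using q by simp
    ultimately show "winding_number C2 w = winding_number C w"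
      unfolding C2_def using winding_number_scale[OF C'(1), of "q * w" "inverse q"] q
      by (metis inverse_nonzero_iff_nonzero)
  qed
  finally show "contour_integral C (\<lambda>z. ?F (inverse q * z) * inverse q) = contour_integral C ?F" .
qed

text \<open>With I(f,g) the integral of the shifted integrand over C, moving the contour turns the
  integral for <Lf,g> into I(g,f) - I(f,g), which changes sign when f and g are exchanged.\<close>

lemma aw_inner_skew:
  assumes q: "norm q < 1" "q \<noteq> 0" and C: "aw_contour q a b c d C"
    and f: "sym_laurent f" and g: "sym_laurent g"
  shows "aw_inner C q a b c d (aw_L q a b c d f) g = - aw_inner C q a b c d f (aw_L q a b c d g)"
proof -
  let ?F = "aw_shift_integrand q a b c d"
  obtain p r where p: "\<And>z. z \<noteq> 0 \<Longrightarrow> f z = laurent_of_poly p z"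
    and r: "\<And>z. z \<noteq> 0 \<Longrightarrow> g z = laurent_of_poly r z"
    using f g unfolding sym_laurent_def sym_laurent_le_iff_poly by metis
  note FG = aw_shift_integral[OF q C p r] and GF = aw_shift_integral[OF q C r p]
  \<comment> \<open>Splitting the integrand only needs C to avoid the first pole, k = 0, of each
    sequence.\<close>
  have on_C: "z \<noteq> 0" "\<And>e. e \<in> {a, b, c, d} \<Longrightarrow> e * z \<noteq> 1" "\<And>e. e \<in> {a, b, c, d} \<Longrightarrow> e \<noteq> z"
    if "z \<in> path_image C" for z
  proof -
    show "z \<noteq> 0"
      using that C by (auto simp: aw_contour_def)
    fix e assume e: "e \<in> {a, b, c, d}"
    then have *: "e * q ^ 0 \<notin> path_image C" "e \<noteq> 0 \<Longrightarrow> inverse (e * q ^ 0) \<notin> path_image C"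
      using C unfolding aw_contour_def by blast+
    show "e \<noteq> z"
      using * that by auto
    show "e * z \<noteq> 1"
      using * that by (metis inverse_unique mult.right_neutral mult_zero_left power_0 zero_neq_one)
  qed
  have "contour_integral C (\<lambda>z. aw_L q a b c d f z * g z * aw_weight q a b c d z / z) =
      contour_integral C (\<lambda>z. ?F g f (inverse q * z) * inverse q - ?F f g z)"
    by (intro contour_integral_eq aw_integrand_split q f on_C)
  also have "\<dots> = contour_integral C (?F g f) - contour_integral C (?F f g)"
    using FG GF by (simp add: contour_integral_diff)
  finally have 1: "contour_integral C (\<lambda>z. aw_L q a b c d f z * g z * aw_weight q a b c d z / z) =
     contour_integral C (?F g f) - contour_integral C (?F f g)" .
  have "contour_integral C (\<lambda>z. f z * aw_L q a b c d g z * aw_weight q a b c d z / z) =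
      contour_integral C (\<lambda>z. ?F f g (inverse q * z) * inverse q - ?F g f z)"
  proof (intro contour_integral_eq)
    fix z assume "z \<in> path_image C"
    from aw_integrand_split[OF q g on_C[OF this], where g = f]
    show "f z * aw_L q a b c d g z * aw_weight q a b c d z / z = ?F f g (inverse q * z) * inverse q - ?F g f z"
      by (simp add: mult_ac)
  qed
  also have "\<dots> = contour_integral C (?F f g) - contour_integral C (?F g f)"
    using FG GF by (simp add: contour_integral_diff)
  finally have 2: "contour_integral C (\<lambda>z. f z * aw_L q a b c d g z * aw_weight q a b c d z / z) =
     contour_integral C (?F f g) - contour_integral C (?F g f)" .
  show ?thesis
    unfolding aw_inner_def 1 2 by (simp add: right_diff_distrib)
qed

section \<open>The structure relation\<close>

definition qp :: "complex \<Rightarrow> complex \<Rightarrow> nat \<Rightarrow> complex" where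
  "qp q u n = (\<Prod>j<n. 1 - u * q ^ j)"

lemma qp_0 [simp]: "qp q u 0 = 1"
  by (simp add: qp_def)

lemma qp_Suc: "qp q u (Suc n) = qp q u n * (1 - u * q ^ n)"
  by (simp add: qp_def)

lemma qp_Suc_shift: "qp q u (Suc n) = (1 - u) * qp q (u * q) n"
  unfolding qp_def prod.lessThan_Suc_shift by (simp add: mult.assoc)

lemma qp_eq_0_iff: "qp q u n = 0 \<longleftrightarrow> (\<exists>j<n. u * q ^ j = 1)"
  by (auto simp: qp_def)

section \<open>Action of L on the basis (az,a/z;q)_k\<close>

definition aw_basis :: "complex \<Rightarrow> complex \<Rightarrow> nat \<Rightarrow> complex \<Rightarrow> complex" where
  "aw_basis q a k z = qp q (a * z) k * qp q (a * inverse z) k"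

text \<open>\<open>aw_alpha\<close>, \<open>aw_beta\<close> and \<open>aw_delta\<close> are the
  coefficients of the basis elements k+1, k and k-1 in the image of element k, with K = q^k as a
  free variable. The first is \<gamma>_k divided by -2aK, the ratio of consecutive leading
  coefficients of the basis.\<close>

definition aw_alpha :: "complex \<Rightarrow> complex \<Rightarrow> complex \<Rightarrow> complex \<Rightarrow> complex \<Rightarrow> complex" where
  "aw_alpha a b c d K = (1 / K - a * b * c * d * K) / (a * K)"

definition aw_beta :: "complex \<Rightarrow> complex \<Rightarrow> complex \<Rightarrow> complex \<Rightarrow> complex \<Rightarrow> complex \<Rightarrow> complex" where
  "aw_beta q a b c d K = (q / K - (1 + q) / K\<^sup>2) / a + (b + c + d) / K - a * (b * c + b * d + c * d) * K
     + a\<^sup>2 * b * c * d * ((1 + 1 / q) * K\<^sup>2 - K / q)"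

text \<open>After the common factor, basis element k-1, has been removed, this is the value left at
  z = q/(aK), where elements k and k+1 contribute nothing. It vanishes for K = 1, that is for k =
  0.\<close>

definition aw_delta :: "complex \<Rightarrow> complex \<Rightarrow> complex \<Rightarrow> complex \<Rightarrow> complex \<Rightarrow> complex \<Rightarrow> complex" where
  "aw_delta q a b c d K = (1 - a * b * K / q) * (1 - a * c * K / q) * (1 - a * d * K / q)
     * (1 - a\<^sup>2 * K\<^sup>2 / q) * (1 / K - 1) * q / (a * K)"


text \<open>Here K = q^k and J = q^(k-1). \<open>X\<close> is (1 - az) times basis element k at qz,
  and \<open>X'\<close> its mirror image under z -> 1/z, both divided by basis element k-1 at z;
  \<open>u\<close> and \<open>u'\<close> are the ratios of consecutive basis elements.\<close>

lemma basis_step_identity: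
  fixes q a b c d J z :: complex
  assumes nz: "q \<noteq> 0" "a \<noteq> 0" "J \<noteq> 0" "z \<noteq> 0"
  defines "K \<equiv> q * J" and "w \<equiv> 1 / z"
  defines "X \<equiv> (1 - a * J * z) * (1 - a * K * z) * (1 - a * w / q)"
    and "X' \<equiv> (1 - a * J * w) * (1 - a * K * w) * (1 - a * z / q)"
    and "u \<equiv> (1 - a * J * z) * (1 - a * J * w)" and "u' \<equiv> (1 - a * K * z) * (1 - a * K * w)"
  shows "(1 - b * z) * (1 - c * z) * (1 - d * z) * w\<^sup>2 * X - (1 - b * w) * (1 - c * w) * (1 - d * w) * z\<^sup>2 * X'
    = (z - w) * (aw_alpha a b c d K * (u * u') + aw_beta q a b c d K * u + aw_delta q a b c d K)"
proof -
  \<comment> \<open>Both sides are linear in the elementary symmetric polynomials of \<open>b, c, d\<close>; comparing their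
     coefficients keeps the expansions small.\<close>
  define g where "g = (1 - a\<^sup>2 * K\<^sup>2 / q) * (1 / K - 1) * q / (a * K)"
  define e1 e2 e3 where "e1 = b + c + d" and "e2 = b * c + b * d + c * d" and "e3 = b * c * d"
  note defs = X_def X'_def u_def u'_def g_def w_def K_def
  have 0: "w\<^sup>2 * X - z\<^sup>2 * X' = (z - w) * (1 / (a * K\<^sup>2) * u * u' + (q / K - (1 + q) / K\<^sup>2) / a * u + g)"
    using nz unfolding defs by (simp add: field_simps power2_eq_square power3_eq_cube)
  have 1: "w * X - z * X' = (z - w) * (- (u / K) + a * J * g)"
    using nz unfolding defs by (simp add: field_simps power2_eq_square power3_eq_cube)
  have 2: "X - X' = (z - w) * (- a * K * u + (a * J)\<^sup>2 * g)"
    using nz unfolding defs by (simp add: field_simps power2_eq_square power3_eq_cube)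
  have 3: "z * X - w * X' = (z - w) * (u * u' - a\<^sup>2 * ((1 + 1 / q) * K\<^sup>2 - K / q) * u + (a * J)^3 * g)"
    using nz unfolding defs by (simp add: field_simps power2_eq_square power3_eq_cube)
  have cubic: "(1 - b * x) * (1 - c * x) * (1 - d * x) * y\<^sup>2 = y\<^sup>2 - e1 * y + e2 - e3 * x"
    if "x * y = 1" for x y
  proof -
    have "x * (y * t) = t" for t
      using that by (simp flip: mult.assoc)
    then show ?thesis
      using that by (simp add: e1_def e2_def e3_def algebra_simps power2_eq_square)
  qed
  have zw: "z * w = 1" "w * z = 1"
    using nz by (auto simp: w_def)
  have "(1 - b * z) * (1 - c * z) * (1 - d * z) * w\<^sup>2 * X - (1 - b * w) * (1 - c * w) * (1 - d * w) * z\<^sup>2 * X'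
    = (w\<^sup>2 * X - z\<^sup>2 * X') - e1 * (w * X - z * X') + e2 * (X - X') - e3 * (z * X - w * X')"
    unfolding cubic[OF zw(1)] cubic[OF zw(2)] by (simp add: algebra_simps)
  also have "\<dots> = (z - w) * ((1 / (a * K\<^sup>2) - e3) * (u * u')
      + ((q / K - (1 + q) / K\<^sup>2) / a + e1 / K - a * e2 * K + a\<^sup>2 * e3 * ((1 + 1 / q) * K\<^sup>2 - K / q)) * u
      + g * (1 - e1 * (a * J) + e2 * (a * J)\<^sup>2 - e3 * (a * J) ^ 3))"
    unfolding 0 1 2 3 by (simp add: ring_distribs mult_ac diff_divide_distrib add_divide_distrib)
  also have "1 / (a * K\<^sup>2) - e3 = aw_alpha a b c d K"
    using nz by (simp add: aw_alpha_def K_def e3_def field_simps power2_eq_square)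
  also have "g * (1 - e1 * (a * J) + e2 * (a * J)\<^sup>2 - e3 * (a * J) ^ 3) = aw_delta q a b c d K"
  proof -
    have "1 - e1 * (a * J) + e2 * (a * J)\<^sup>2 - e3 * (a * J) ^ 3 = (1 - a * b * K / q) * (1 - a * c * K / q) * (1 - a * d * K / q)"
      using nz by (simp add: K_def e1_def e2_def e3_def algebra_simps power2_eq_square power3_eq_cube)
    then show ?thesis
      by (simp add: g_def aw_delta_def)
  qed
  finally show ?thesis
    by (simp add: aw_beta_def e1_def e2_def e3_def mult.assoc)
qed

lemma basis_zero_identity:
  fixes q a b c d z :: complex
  assumes "q \<noteq> 0" "a \<noteq> 0" "z \<noteq> 0"
  defines "w \<equiv> 1 / z"
  shows "(1 - a * z) * (1 - b * z) * (1 - c * z) * (1 - d * z) * w\<^sup>2 - (1 - a * w) * (1 - b * w) * (1 - c * w) * (1 - d * w) * z\<^sup>2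
    = (z - w) * (aw_alpha a b c d 1 * ((1 - a * z) * (1 - a * w)) + aw_beta q a b c d 1)"
  using assms(1-3) unfolding w_def aw_alpha_def aw_beta_def
  by (simp add: field_simps power2_eq_square power3_eq_cube)

text \<open>The comparison of coefficients at basis element 0, with N = q^n. The summand next to
  \<open>aw_beta\<close> is the contribution that \<open>aw_delta\<close> moves down from element
  1.\<close>

lemma match_zero_identity:
  fixes q a b c d N :: complex
  assumes "q \<noteq> 0" "a \<noteq> 0" "N \<noteq> 0"
  defines "D \<equiv> a * b * c * d" and "M \<equiv> N / q"
  shows "(1 - N\<^sup>2 * D / q) * (aw_beta q a b c d 1 + (1 - 1 / N) * (1 - N * D / q) * (1 - q * a\<^sup>2) / a)
    = - ((1 - N * D / q) * (1 - a * b * N) * (1 - a * c * N) * (1 - a * d * N) / (a * N))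
      + a * (1 - b * c * M) * (1 - b * d * M) * (1 - c * d * M) * (1 - N) / M"
  using assms(1-3) unfolding aw_beta_def D_def M_def
  by (simp add: field_simps power2_eq_square power3_eq_cube)

text \<open>The comparison of coefficients at basis element j > 0, with J = q^(j-1) and K = q^j,
  after division by the coefficient of p_n at j-1 and multiplication by the denominator of the ratio
  of consecutive coefficients.\<close>

lemma match_step_identity:
  fixes q a b c d N J :: complex
  assumes nz: "q \<noteq> 0" "a \<noteq> 0" "N \<noteq> 0" "J \<noteq> 0"
  defines "D \<equiv> a * b * c * d" and "M \<equiv> N / q" and "K \<equiv> q * J"
  shows "(1 - N\<^sup>2 * D / q) * (aw_alpha a b c d J * ((1 - a * b * J) * (1 - a * c * J) * (1 - a * d * J) * (1 - K))
      + q * (1 - J / N) * (1 - N * D * J / q) * (aw_beta q a b c d K + (1 - K / N) * (1 - N * D * K / q) * (1 - q * a\<^sup>2 * K\<^sup>2) / (a * K\<^sup>2)))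
    = - ((1 - a * b * N) * (1 - a * c * N) * (1 - a * d * N) * (1 - 1 / (q * N)) * (1 - N * D * J / q) * (1 - N * D * K / q) * q / (a * N))
      - a * q * q * (1 - b * c * M) * (1 - b * d * M) * (1 - c * d * M) * (1 - J / N) * (1 - K / N) * (1 - N * D / q\<^sup>2)"
proof -
  \<comment> \<open>For fixed \<open>D\<close> both sides are affine in \<open>e1\<close> and \<open>e2\<close>; their coefficients are compared separately.\<close>
  define e1 e2 where "e1 = b + c + d" and "e2 = b * c + b * d + c * d"
  define P \<alpha> where "P = 1 - N\<^sup>2 * D / q" and "\<alpha> = (1 / J - D * J) / (a * J)"
  define S where "S = q * (1 - J / N) * (1 - N * D * J / q)"
  define G where "G = (1 - K / N) * (1 - N * D * K / q) * (1 - q * a\<^sup>2 * K\<^sup>2) / (a * K\<^sup>2)"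
  define T where "T = (1 - 1 / (q * N)) * (1 - N * D * J / q) * (1 - N * D * K / q) * q / (a * N)"
  define U where "U = a * q * q * (1 - J / N) * (1 - K / N) * (1 - N * D / q\<^sup>2)"
  note defs = P_def \<alpha>_def S_def G_def T_def U_def M_def K_def
  have 0: "P * (\<alpha> * (1 - K) * (1 - a\<^sup>2 * D * J ^ 3)
      + S * ((q / K - (1 + q) / K\<^sup>2) / a + a * D * ((1 + 1 / q) * K\<^sup>2 - K / q) + G))
    = - (T * (1 - a\<^sup>2 * D * N ^ 3)) - U * (1 - (D / a)\<^sup>2 * M ^ 3)"
    using nz unfolding defs by (simp add: field_simps power2_eq_square power3_eq_cube)
  have 1: "P * (S / K - \<alpha> * (1 - K) * (a * J)) = T * (a * N) - U * (D / a) * M\<^sup>2"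
    using nz unfolding defs by (simp add: field_simps power2_eq_square power3_eq_cube)
  have 2: "P * (\<alpha> * (1 - K) * (a * J)\<^sup>2 - S * (a * K)) = U * M - T * (a * N)\<^sup>2"
    using nz unfolding defs by (simp add: field_simps power2_eq_square power3_eq_cube)
  have e3: "b * c * d = D / a"
    using nz by (simp add: D_def)
  have cubic: "(1 - a * b * x) * (1 - a * c * x) * (1 - a * d * x) = 1 - e1 * (a * x) + e2 * (a * x)\<^sup>2 - a\<^sup>2 * D * x ^ 3" for x
    by (simp add: e1_def e2_def D_def algebra_simps power2_eq_square power3_eq_cube)
  have cubic': "(1 - b * c * M) * (1 - b * d * M) * (1 - c * d * M) = 1 - e2 * M + e1 * (D / a) * M\<^sup>2 - (D / a)\<^sup>2 * M ^ 3"
    unfolding e3[symmetric] by (simp add: e1_def e2_def algebra_simps power2_eq_square power3_eq_cube)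
  have \<beta>: "aw_beta q a b c d K = (q / K - (1 + q) / K\<^sup>2) / a + e1 / K - e2 * (a * K) + a * D * ((1 + 1 / q) * K\<^sup>2 - K / q)"
    by (simp add: aw_beta_def e1_def e2_def D_def power2_eq_square mult_ac)
  have "P * (aw_alpha a b c d J * ((1 - a * b * J) * (1 - a * c * J) * (1 - a * d * J) * (1 - K))
      + S * (aw_beta q a b c d K + G)) =
    P * (\<alpha> * (1 - K) * (1 - a\<^sup>2 * D * J ^ 3)
      + S * ((q / K - (1 + q) / K\<^sup>2) / a + a * D * ((1 + 1 / q) * K\<^sup>2 - K / q) + G))
    + e1 * (P * (S / K - \<alpha> * (1 - K) * (a * J))) + e2 * (P * (\<alpha> * (1 - K) * (a * J)\<^sup>2 - S * (a * K)))"
    unfolding cubic \<beta> aw_alpha_def D_def[symmetric] \<alpha>_def[symmetric]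
    by (simp add: ring_distribs mult_ac)
  also have "\<dots> = - (T * ((1 - a * b * N) * (1 - a * c * N) * (1 - a * d * N)))
      - U * ((1 - b * c * M) * (1 - b * d * M) * (1 - c * d * M))"
    unfolding 0 1 2 cubic cubic' by (simp add: ring_distribs mult_ac)
  finally show ?thesis
    by (simp add: P_def S_def G_def T_def U_def mult_ac)
qed


text \<open>The factor 1 - az completes (aqz;q)_k to (az;q)_(k+1), while (a/(qz);q)_k starts one
  factor before (a/z;q)_(k-1). All terms therefore contain basis element k-1, and dividing by it
  leaves a fixed rational identity. For k = 0 there is no such factor; the truncated index k - 1
  does no harm then, because \<open>aw_delta\<close> vanishes.\<close>

lemma aw_numerator_basis:
  fixes q a b c d z :: complex
  assumes q: "q \<noteq> 0" and a: "a \<noteq> 0" and z: "z \<noteq> 0"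
  shows "aw_numerator q a b c d (aw_basis q a k) z = (z - inverse z) *
    (aw_alpha a b c d (q ^ k) * aw_basis q a (Suc k) z + aw_beta q a b c d (q ^ k) * aw_basis q a k z
     + aw_delta q a b c d (q ^ k) * aw_basis q a (k - 1) z)"
proof (cases k)
  case 0
  have "aw_numerator q a b c d (aw_basis q a 0) z =
      (1 - a * z) * (1 - b * z) * (1 - c * z) * (1 - d * z) * (1 / z)\<^sup>2
      - (1 - a * (1 / z)) * (1 - b * (1 / z)) * (1 - c * (1 / z)) * (1 - d * (1 / z)) * z\<^sup>2"
    by (simp add: aw_numerator_def aw_basis_def power_int_minus power_inverse divide_inverse)
  also have "\<dots> = (z - 1 / z) * (aw_alpha a b c d 1 * ((1 - a * z) * (1 - a * (1 / z))) + aw_beta q a b c d 1)"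
    using basis_zero_identity[OF q a z] by simp
  finally show ?thesis
    using 0 by (simp add: aw_basis_def qp_Suc aw_delta_def divide_inverse)
next
  case (Suc m)
  define J where "J = q ^ m"
  define K where "K = q * J"
  define w where "w = 1 / z"
  define B where "B = aw_basis q a m z"
  have J: "J \<noteq> 0"
    using q by (simp add: J_def)
  have w: "inverse z = w" "z * w = 1" "w \<noteq> 0"
    using z by (auto simp: w_def divide_inverse)
  have K: "q ^ k = K"
    by (simp add: Suc K_def J_def)
  have up: "(1 - a * x) * aw_basis q a k (q * x) = B * ((1 - a * J * x) * (1 - a * K * x) * (1 - a * y / q))"
    if xy: "(x = z \<and> y = w) \<or> (x = w \<and> y = z)" for x y
  proof -
    have "x * y = 1"
      using xy w by (auto simp: mult.commute)
    then have inv: "inverse (q * x) = y / q"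
      by (simp add: inverse_unique divide_inverse)
    have B: "B = qp q (a * x) m * qp q (a * y) m"
      using xy w by (auto simp: B_def aw_basis_def)
    have "(1 - a * x) * qp q (a * x * q) k = qp q (a * x) m * (1 - a * J * x) * (1 - a * K * x)"
    proof -
      have "(1 - a * x) * qp q (a * x * q) k = qp q (a * x) (Suc (Suc m))"
        unfolding Suc qp_Suc_shift[of q "a * x" "Suc m"] ..
      then show ?thesis
        by (simp add: qp_Suc J_def K_def mult_ac)
    qed
    moreover have "qp q (a * (y / q)) k = (1 - a * y / q) * qp q (a * y) m"
      unfolding Suc qp_Suc_shift using q by simp
    ultimately show ?thesis
      unfolding aw_basis_def inv B by (simp add: mult_ac)
  qed
  have down: "aw_basis q a k (inverse q * z) = aw_basis q a k (q * w)"
    using w q z by (simp add: aw_basis_def w_def field_simps)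
  have "aw_numerator q a b c d (aw_basis q a k) z =
      (1 - b * z) * (1 - c * z) * (1 - d * z) * w\<^sup>2 * ((1 - a * z) * aw_basis q a k (q * z))
      - (1 - b * w) * (1 - c * w) * (1 - d * w) * z\<^sup>2 * ((1 - a * w) * aw_basis q a k (q * w))"
    unfolding aw_numerator_def down using w
    by (simp add: power_int_minus flip: power_inverse) (simp add: divide_inverse w mult_ac)
  also have "\<dots> = B * ((1 - b * z) * (1 - c * z) * (1 - d * z) * w\<^sup>2 * ((1 - a * J * z) * (1 - a * K * z) * (1 - a * w / q))
      - (1 - b * w) * (1 - c * w) * (1 - d * w) * z\<^sup>2 * ((1 - a * J * w) * (1 - a * K * w) * (1 - a * z / q)))"
    using up[of z w] up[of w z] by (simp add: right_diff_distrib mult_ac)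
  also have "\<dots> = B * ((z - w) * (aw_alpha a b c d K * (((1 - a * J * z) * (1 - a * J * w)) * ((1 - a * K * z) * (1 - a * K * w)))
      + aw_beta q a b c d K * ((1 - a * J * z) * (1 - a * J * w)) + aw_delta q a b c d K))"
    using basis_step_identity[OF q a J z, of b c d] unfolding K_def w_def by simp
  also have "\<dots> = (z - w) *
    (aw_alpha a b c d K * (B * ((1 - a * J * z) * (1 - a * J * w)) * ((1 - a * K * z) * (1 - a * K * w)))
      + aw_beta q a b c d K * (B * ((1 - a * J * z) * (1 - a * J * w))) + aw_delta q a b c d K * B)"
    by (simp add: ring_distribs mult_ac)
  also have "B * ((1 - a * J * z) * (1 - a * J * w)) = aw_basis q a k z"
    by (simp add: B_def aw_basis_def Suc qp_Suc J_def w mult_ac)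
  also have "aw_basis q a k z * ((1 - a * K * z) * (1 - a * K * w)) = aw_basis q a (Suc k) z"
    by (simp add: aw_basis_def qp_Suc K w mult_ac)
  finally show ?thesis
    unfolding K w(1) using Suc by (simp add: B_def)
qed

section \<open>Coefficients of the Askey-Wilson polynomials for nonzero a\<close>

definition aw_coeff :: "complex \<Rightarrow> complex \<Rightarrow> complex \<Rightarrow> complex \<Rightarrow> complex \<Rightarrow> complex \<Rightarrow> nat \<Rightarrow> complex" where
  "aw_coeff q a b c d N k = qp q (inverse N) k * qp q (N * (a * b * c * d) / q) k
     / (qp q (a * b) k * qp q (a * c) k * qp q (a * d) k * qp q q k) * q ^ k"

definition aw_pre :: "complex \<Rightarrow> complex \<Rightarrow> complex \<Rightarrow> complex \<Rightarrow> complex \<Rightarrow> nat \<Rightarrow> complex" where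
  "aw_pre q a b c d n = qp q (a * b) n * qp q (a * c) n * qp q (a * d) n / a ^ n"

text \<open>The factor (q^(-n);q)_k contains 1 - q^(-n) q^n once k exceeds n. Hence p_(n-1), p_n and
  p_(n+1) can be summed over a common range of k.\<close>

lemma aw_coeff_eq_0:
  assumes "q \<noteq> 0" "n < k"
  shows "aw_coeff q a b c d (q ^ n) k = 0"
proof -
  have "qp q (inverse (q ^ n)) k = 0"
    unfolding qp_eq_0_iff using assms by (intro exI[of _ n]) auto
  then show ?thesis
    by (simp add: aw_coeff_def)
qed

lemma aw_poly_formula_eq:
  assumes q: "q \<noteq> 0" and m: "n \<le> m"
  shows "aw_poly_formula q a b c d n z =
    aw_pre q a b c d n * (\<Sum>k\<le>m. aw_coeff q a b c d (q ^ n) k * aw_basis q a k z)"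
proof -
  have "aw_poly_formula q a b c d n z =
      aw_pre q a b c d n * (\<Sum>k\<le>n. aw_coeff q a b c d (q ^ n) k * aw_basis q a k z)"
    using q by (simp add: aw_poly_formula_def aw_pre_def aw_coeff_def aw_basis_def qpoch_def power_int_minus
        power_int_diff mult_ac flip: qp_def)
  also have "(\<Sum>k\<le>n. aw_coeff q a b c d (q ^ n) k * aw_basis q a k z) =
      (\<Sum>k\<le>m. aw_coeff q a b c d (q ^ n) k * aw_basis q a k z)"
    using m q by (intro sum.mono_neutral_left) (auto simp: aw_coeff_eq_0)
  finally show ?thesis .
qed

text \<open>Collects the coefficient of each \<open>\<phi> j\<close>. The vanishing of
  \<open>t\<close> beyond n allows the ranges to be extended, and \<open>\<delta> 0 = 0\<close>
  removes the term in which the truncated k - 1 would give \<open>\<phi> 0\<close> once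
  more.\<close>

lemma sum_three_term_shift:
  fixes t \<alpha> \<beta> \<delta> \<phi> :: "nat \<Rightarrow> 'a::comm_ring_1"
  assumes t: "\<And>k. k > n \<Longrightarrow> t k = 0" and "\<delta> 0 = 0"
  shows "(\<Sum>k\<le>n. t k * (\<alpha> k * \<phi> (Suc k) + \<beta> k * \<phi> k + \<delta> k * \<phi> (k - 1))) =
    (\<Sum>j\<le>Suc n. ((case j of 0 \<Rightarrow> 0 | Suc i \<Rightarrow> t i * \<alpha> i) + t j * \<beta> j + t (Suc j) * \<delta> (Suc j)) * \<phi> j)"
proof -
  have "(\<Sum>k\<le>n. t k * (\<alpha> k * \<phi> (Suc k))) = (\<Sum>j\<le>Suc n. (case j of 0 \<Rightarrow> 0 | Suc i \<Rightarrow> t i * \<alpha> i) * \<phi> j)"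
    unfolding sum.atMost_Suc_shift by (simp add: mult.assoc)
  moreover have "(\<Sum>k\<le>n. t k * (\<beta> k * \<phi> k)) = (\<Sum>j\<le>Suc n. t j * \<beta> j * \<phi> j)"
    by (simp add: t mult.assoc)
  moreover have "(\<Sum>k\<le>n. t k * (\<delta> k * \<phi> (k - 1))) = (\<Sum>j\<le>Suc n. t (Suc j) * \<delta> (Suc j) * \<phi> j)"
  proof -
    have "(\<Sum>k\<le>n. t k * (\<delta> k * \<phi> (k - 1))) = (\<Sum>k\<le>Suc (Suc n). t k * (\<delta> k * \<phi> (k - 1)))"
      by (simp add: t)
    also have "\<dots> = (\<Sum>j\<le>Suc n. t (Suc j) * \<delta> (Suc j) * \<phi> j)"
      unfolding sum.atMost_Suc_shift[of _ "Suc n"] using assms(2) by (simp add: mult.assoc)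
    finally show ?thesis .
  qed
  ultimately show ?thesis
    by (simp only: distrib_left distrib_right sum.distrib)
qed

abbreviation (input) aw_ratio_denom :: "complex \<Rightarrow> complex \<Rightarrow> complex \<Rightarrow> complex \<Rightarrow> complex \<Rightarrow> complex \<Rightarrow> complex" where
  "aw_ratio_denom q a b c d J \<equiv> (1 - a * b * J) * (1 - a * c * J) * (1 - a * d * J) * (1 - q * J)"

context
  fixes q a b c d :: complex
  assumes q: "q \<noteq> 0" and q_root: "\<And>k. q ^ Suc k \<noteq> 1" and a: "a \<noteq> 0"
    and params: "\<And>k. a * b * q ^ k \<noteq> 1" "\<And>k. a * c * q ^ k \<noteq> 1" "\<And>k. a * d * q ^ k \<noteq> 1"
begin

lemma aw_ratio_denom_nz: "aw_ratio_denom q a b c d (q ^ m) \<noteq> 0"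
  using params[of m] q_root[of m] by simp

lemma aw_coeff_Suc:
  "aw_coeff q a b c d N (Suc m) = aw_coeff q a b c d N m *
     ((1 - q ^ m / N) * (1 - N * (a * b * c * d) * q ^ m / q) * q / aw_ratio_denom q a b c d (q ^ m))"
  by (simp add: aw_coeff_def qp_Suc divide_inverse mult_ac)

text \<open>Passing from n to n+1 replaces N by qN, which moves the starting points of (1/N;q) and
  (N abcd/q;q) by one step in opposite directions. The factor on the left may vanish and is
  therefore not divided out.\<close>

lemma aw_coeff_times_q:
  assumes "N \<noteq> 0"
  shows "(1 - N * (a * b * c * d) / q) * aw_coeff q a b c d (q * N) (Suc m) = aw_coeff q a b c d N m *
     ((1 - 1 / (q * N)) * (1 - N * (a * b * c * d) * q ^ m / q) * (1 - N * (a * b * c * d) * q ^ Suc m / q) * q / aw_ratio_denom q a b c d (q ^ m))"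
proof -
  have "qp q (inverse (q * N)) (Suc m) = (1 - 1 / (q * N)) * qp q (inverse N) m"
  proof -
    have e: "inverse (q * N) * q = inverse N"
      using q by simp
    show ?thesis
      unfolding qp_Suc_shift e by (simp add: divide_inverse)
  qed
  moreover have "(1 - N * (a * b * c * d) / q) * qp q (q * N * (a * b * c * d) / q) (Suc m) =
      qp q (N * (a * b * c * d) / q) m * (1 - N * (a * b * c * d) * q ^ m / q) * (1 - N * (a * b * c * d) * q ^ Suc m / q)"
  proof -
    have e: "q * N * (a * b * c * d) / q = N * (a * b * c * d) / q * q"
      using q by simp
    show ?thesis
      unfolding e qp_Suc_shift[symmetric] by (simp add: qp_Suc mult_ac)
  qed
  ultimately show ?thesis
    unfolding aw_coeff_def by (simp add: qp_Suc divide_inverse mult_ac)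
qed

lemma aw_coeff_over_q:
  assumes "N \<noteq> 0"
  shows "(1 - 1 / N) * aw_coeff q a b c d (N / q) (Suc m) = aw_coeff q a b c d N m *
     ((1 - q ^ m / N) * (1 - q ^ Suc m / N) * (1 - N * (a * b * c * d) / q\<^sup>2) * q / aw_ratio_denom q a b c d (q ^ m))"
proof -
  have 1: "(1 - 1 / N) * qp q (inverse (N / q)) (Suc m) = qp q (inverse N) m * (1 - q ^ m / N) * (1 - q ^ Suc m / N)"
  proof -
    have e: "inverse (N / q) = inverse N * q"
      by (simp add: divide_inverse)
    have "(1 - 1 / N) * qp q (inverse (N / q)) (Suc m) = qp q (inverse N) (Suc (Suc m))"
      unfolding e qp_Suc_shift[of q "inverse N" "Suc m"] by (simp add: divide_inverse)
    also have "\<dots> = qp q (inverse N) m * (1 - q ^ m / N) * (1 - q ^ Suc m / N)"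
      unfolding qp_Suc by (simp add: divide_inverse mult.commute)
    finally show ?thesis .
  qed
  have 2: "qp q (N / q * (a * b * c * d) / q) (Suc m) = (1 - N * (a * b * c * d) / q\<^sup>2) * qp q (N * (a * b * c * d) / q) m"
    unfolding qp_Suc_shift using q by (simp add: power2_eq_square mult_ac)
  have "(1 - 1 / N) * aw_coeff q a b c d (N / q) (Suc m) =
      ((1 - 1 / N) * qp q (inverse (N / q)) (Suc m)) * qp q (N / q * (a * b * c * d) / q) (Suc m)
      / (qp q (a * b) (Suc m) * qp q (a * c) (Suc m) * qp q (a * d) (Suc m) * qp q q (Suc m)) * q ^ Suc m"
    by (simp add: aw_coeff_def)
  then show ?thesis
    unfolding 1 2 by (simp add: aw_coeff_def qp_Suc mult_ac)
qed

text \<open>\<open>aw_delta\<close> contains the denominator of the ratio of consecutive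
  coefficients as a factor, so no new denominator in ab, ac, ad appears.\<close>

lemma aw_coeff_delta:
  "aw_coeff q a b c d N (Suc m) * aw_delta q a b c d (q ^ Suc m) = aw_coeff q a b c d N m *
     ((1 - q ^ m / N) * (1 - N * (a * b * c * d) * q ^ m / q) * (1 - q * a\<^sup>2 * (q ^ m)\<^sup>2) / (a * (q ^ m)\<^sup>2))"
proof -
  have "aw_delta q a b c d (q * J) = aw_ratio_denom q a b c d J * ((1 - q * a\<^sup>2 * J\<^sup>2) / (a * J\<^sup>2) / q)" if "J \<noteq> 0" for J
  proof -
    have 1: "P * (1 / (q * J) - 1) * q / (a * (q * J)) = P * ((1 - q * J) / (a * J\<^sup>2) / q)" for P
      using that q a by (simp add: field_simps power2_eq_square)
    have 2: "a\<^sup>2 * (q * J)\<^sup>2 / q = q * a\<^sup>2 * J\<^sup>2" "a * e * (q * J) / q = a * e * J" for e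
      using q by (simp_all add: field_simps power2_eq_square)
    show ?thesis
      unfolding aw_delta_def 2 1 by (simp add: mult_ac)
  qed
  from this[of "q ^ m"] show ?thesis
    unfolding aw_coeff_Suc using aw_ratio_denom_nz[of m] q by simp
qed

text \<open>This is the structure relation at basis element j, divided by the prefactor of p_n. The
  factor (1-abN)(1-acN)(1-adN)/a is the ratio of the prefactors of p_(n+1) and p_n; the ratio for
  p_(n-1) cancels the three factors in ab, ac, ad and leaves those in bc, bd, cd.\<close>

lemma aw_coeff_match:
  assumes N: "N \<noteq> 0"
  defines "D \<equiv> a * b * c * d" and "M \<equiv> N / q"
  shows "(1 - N\<^sup>2 * D / q) * ((case j of 0 \<Rightarrow> 0 | Suc i \<Rightarrow> aw_coeff q a b c d N i * aw_alpha a b c d (q ^ i))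
      + aw_coeff q a b c d N j * aw_beta q a b c d (q ^ j)
      + aw_coeff q a b c d N (Suc j) * aw_delta q a b c d (q ^ Suc j))
    = - ((1 - N * D / q) * ((1 - a * b * N) * (1 - a * c * N) * (1 - a * d * N) / (a * N)) * aw_coeff q a b c d (q * N) j)
      + a * (1 - b * c * M) * (1 - b * d * M) * (1 - c * d * M) * (1 - N) / M * aw_coeff q a b c d (N / q) j"
proof (cases j)
  case 0
  have [simp]: "aw_coeff q a b c d N' 0 = 1" for N'
    by (simp add: aw_coeff_def)
  show ?thesis
    using match_zero_identity[OF q a N, of b c d] aw_coeff_delta[of N 0] unfolding 0 D_def M_def
    by (simp add: mult.assoc)
next
  case (Suc m)
  define J where "J = q ^ m"
  define K where "K = q * J"
  define t where "t = aw_coeff q a b c d N m"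
  have nz: "J \<noteq> 0" "aw_ratio_denom q a b c d J \<noteq> 0"
    using q aw_ratio_denom_nz[of m] by (simp_all add: J_def)
  have KJ: "q ^ Suc m = K"
    by (simp add: K_def J_def)
  have 1: "aw_coeff q a b c d N (Suc m) = t * ((1 - J / N) * (1 - N * D * J / q) * q / aw_ratio_denom q a b c d J)"
    unfolding t_def J_def D_def by (rule aw_coeff_Suc)
  have 2: "aw_coeff q a b c d N (Suc (Suc m)) * aw_delta q a b c d (q ^ Suc (Suc m)) =
      aw_coeff q a b c d N (Suc m) * ((1 - K / N) * (1 - N * D * K / q) * (1 - q * a\<^sup>2 * K\<^sup>2) / (a * K\<^sup>2))"
    using aw_coeff_delta[of N "Suc m"] unfolding KJ D_def .
  have 3: "(1 - N * D / q) * aw_coeff q a b c d (q * N) (Suc m) =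
      t * ((1 - 1 / (q * N)) * (1 - N * D * J / q) * (1 - N * D * K / q) * q / aw_ratio_denom q a b c d J)"
    using aw_coeff_times_q[OF N, of m] unfolding KJ J_def[symmetric] t_def D_def .
  have 4: "(1 - 1 / N) * aw_coeff q a b c d (N / q) (Suc m) =
      t * ((1 - J / N) * (1 - K / N) * (1 - N * D / q\<^sup>2) * q / aw_ratio_denom q a b c d J)"
    using aw_coeff_over_q[OF N, of m] unfolding KJ J_def[symmetric] t_def D_def .
  \<comment> \<open>Brings out the factor 1 - 1/N with which the coefficient for N/q is
    known.\<close>
  have NM: "(1 - N) / M = - (q * (1 - 1 / N))"
    using N q by (simp add: M_def field_simps)
  define G where "G = (1 - K / N) * (1 - N * D * K / q) * (1 - q * a\<^sup>2 * K\<^sup>2) / (a * K\<^sup>2)"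
  define h where "h = aw_ratio_denom q a b c d J"
  have factor: "P * (t * x + t * (r * s * q / h) * y + t * (r * s * q / h) * G)
      = t / h * (P * (x * h + q * r * s * (y + G)))" for P x y r s
    using nz(2)[folded h_def] by (simp add: field_simps)
  have "(1 - N\<^sup>2 * D / q) * (t * aw_alpha a b c d J
      + aw_coeff q a b c d N (Suc m) * aw_beta q a b c d K
      + aw_coeff q a b c d N (Suc m) * G) = t / h * ((1 - N\<^sup>2 * D / q) * (aw_alpha a b c d J * h
      + q * (1 - J / N) * (1 - N * D * J / q) * (aw_beta q a b c d K + G)))"
    unfolding 1 h_def[symmetric] by (rule factor)
  also have "(1 - N\<^sup>2 * D / q) * (aw_alpha a b c d J * h
      + q * (1 - J / N) * (1 - N * D * J / q) * (aw_beta q a b c d K + G)) =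
     - ((1 - a * b * N) * (1 - a * c * N) * (1 - a * d * N) * (1 - 1 / (q * N)) * (1 - N * D * J / q) * (1 - N * D * K / q) * q / (a * N))
      - a * q * q * (1 - b * c * M) * (1 - b * d * M) * (1 - c * d * M) * (1 - J / N) * (1 - K / N) * (1 - N * D / q\<^sup>2)"
    using match_step_identity[OF q a N nz(1), of b c d] unfolding G_def h_def K_def D_def M_def by simp
  also have "t / h * \<dots> = - (((1 - a * b * N) * (1 - a * c * N) * (1 - a * d * N) / (a * N)) *
        (t * ((1 - 1 / (q * N)) * (1 - N * D * J / q) * (1 - N * D * K / q) * q / h)))
      - a * (1 - b * c * M) * (1 - b * d * M) * (1 - c * d * M) * q *
        (t * ((1 - J / N) * (1 - K / N) * (1 - N * D / q\<^sup>2) * q / h))"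
  proof -
    have "t / h * (- (x1 * x2 * x3 * x4 * x5 * x6 * q / (a * N)) - a * q * q * y1 * y2 * y3 * y4 * y5 * y6)
      = - ((x1 * x2 * x3 / (a * N)) * (t * (x4 * x5 * x6 * q / h))) - a * y1 * y2 * y3 * q * (t * (y4 * y5 * y6 * q / h))"
      for x1 x2 x3 x4 x5 x6 y1 y2 y3 y4 y5 y6
      by (simp add: right_diff_distrib mult_ac)
    then show ?thesis .
  qed
  also have "\<dots> = - ((1 - N * D / q) * ((1 - a * b * N) * (1 - a * c * N) * (1 - a * d * N) / (a * N)) * aw_coeff q a b c d (q * N) (Suc m))
      + a * (1 - b * c * M) * (1 - b * d * M) * (1 - c * d * M) * ((1 - N) / M) * aw_coeff q a b c d (N / q) (Suc m)"
    unfolding h_def 3[symmetric] 4[symmetric] NM by (simp only: mult_ac mult_minus_right mult_minus_left diff_conv_add_uminus)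
  finally show ?thesis
    unfolding Suc 2[folded G_def] KJ by (simp add: t_def J_def)
qed

lemma aw_structure_numerator:
  fixes n :: nat
  assumes n: "n > 0" and z: "z \<noteq> 0"
  defines "D \<equiv> a * b * c * d" and "N \<equiv> q ^ n"
  defines "M \<equiv> N / q"
  shows "(1 - N\<^sup>2 * D / q) * aw_numerator q a b c d (aw_poly_formula q a b c d n) z = (z - inverse z) *
    (- ((1 - N * D / q) / N * aw_poly_formula q a b c d (n + 1) z)
     + (1 - a * b * M) * (1 - a * c * M) * (1 - a * d * M) * (1 - b * c * M) * (1 - b * d * M) * (1 - c * d * M)
       * (1 - N) / M * aw_poly_formula q a b c d (n - 1) z)"
proof -
  let ?t = "aw_coeff q a b c d N"
  let ?S = "\<lambda>N'. \<Sum>j\<le>Suc n. aw_coeff q a b c d N' j * aw_basis q a j z"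
  have N: "N \<noteq> 0"
    using q by (simp add: N_def)
  have fun_eq: "aw_poly_formula q a b c d n = (\<lambda>z. aw_pre q a b c d n * (\<Sum>k\<le>n. ?t k * aw_basis q a k z))"
    using aw_poly_formula_eq[OF q order.refl, of a b c d n] by (simp add: fun_eq_iff N_def)
  have lin: "aw_numerator q a b c d (\<lambda>z. C * (\<Sum>k\<le>n. t k * f k z)) z = C * (\<Sum>k\<le>n. t k * aw_numerator q a b c d (f k) z)"
    for C t and f :: "nat \<Rightarrow> complex \<Rightarrow> complex"
  proof -
    have "X * (C * (\<Sum>k\<le>n. t k * u k)) - Y * (C * (\<Sum>k\<le>n. t k * v k)) = C * (\<Sum>k\<le>n. t k * (X * u k - Y * v k))"
      for X Y and u v :: "nat \<Rightarrow> complex"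
      by (simp add: sum_distrib_left right_diff_distrib sum_subtractf mult_ac)
    then show ?thesis
      by (simp add: aw_numerator_def)
  qed
  have "aw_numerator q a b c d (aw_poly_formula q a b c d n) z = aw_pre q a b c d n * (\<Sum>k\<le>n. ?t k * ((z - inverse z) *
      (aw_alpha a b c d (q ^ k) * aw_basis q a (Suc k) z + aw_beta q a b c d (q ^ k) * aw_basis q a k z
     + aw_delta q a b c d (q ^ k) * aw_basis q a (k - 1) z)))"
    unfolding fun_eq lin aw_numerator_basis[OF q a z] ..
  also have "\<dots> = (z - inverse z) * aw_pre q a b c d n * (\<Sum>k\<le>n. ?t k *
      (aw_alpha a b c d (q ^ k) * aw_basis q a (Suc k) z + aw_beta q a b c d (q ^ k) * aw_basis q a k z
     + aw_delta q a b c d (q ^ k) * aw_basis q a (k - 1) z))"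
    unfolding mult.left_commute[of "?t _" "z - inverse z"] sum_distrib_left[symmetric] by (simp only: mult_ac)
  also have "(\<Sum>k\<le>n. ?t k *
      (aw_alpha a b c d (q ^ k) * aw_basis q a (Suc k) z + aw_beta q a b c d (q ^ k) * aw_basis q a k z
     + aw_delta q a b c d (q ^ k) * aw_basis q a (k - 1) z)) =
     (\<Sum>j\<le>Suc n. ((case j of 0 \<Rightarrow> 0 | Suc i \<Rightarrow> ?t i * aw_alpha a b c d (q ^ i))
      + ?t j * aw_beta q a b c d (q ^ j) + ?t (Suc j) * aw_delta q a b c d (q ^ Suc j)) * aw_basis q a j z)"
    by (rule sum_three_term_shift) (use q in \<open>simp_all add: N_def aw_coeff_eq_0 aw_delta_def\<close>)
  finally have num: "aw_numerator q a b c d (aw_poly_formula q a b c d n) z = (z - inverse z) * aw_pre q a b c d n *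
    (\<Sum>j\<le>Suc n. ((case j of 0 \<Rightarrow> 0 | Suc i \<Rightarrow> ?t i * aw_alpha a b c d (q ^ i))
      + ?t j * aw_beta q a b c d (q ^ j) + ?t (Suc j) * aw_delta q a b c d (q ^ Suc j)) * aw_basis q a j z)" .
  define X where "X = (1 - N * D / q) * ((1 - a * b * N) * (1 - a * c * N) * (1 - a * d * N) / (a * N))"
  define Y where "Y = a * (1 - b * c * M) * (1 - b * d * M) * (1 - c * d * M) * (1 - N) / M"
  have "(1 - N\<^sup>2 * D / q) * (\<Sum>j\<le>Suc n. ((case j of 0 \<Rightarrow> 0 | Suc i \<Rightarrow> ?t i * aw_alpha a b c d (q ^ i))
      + ?t j * aw_beta q a b c d (q ^ j) + ?t (Suc j) * aw_delta q a b c d (q ^ Suc j)) * aw_basis q a j z)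
    = (\<Sum>j\<le>Suc n. (- (X * aw_coeff q a b c d (q * N) j) + Y * aw_coeff q a b c d (N / q) j) * aw_basis q a j z)"
    unfolding sum_distrib_left mult.assoc[symmetric, of "1 - N\<^sup>2 * D / q"]
    by (intro sum.cong refl arg_cong2[where f = "(*)"], unfold X_def Y_def M_def D_def, rule aw_coeff_match[OF N])
  also have "\<dots> = - (X * ?S (q * N)) + Y * ?S (N / q)"
    by (simp only: distrib_right sum.distrib sum_negf mult_minus_left sum_distrib_left mult.assoc)
  finally have S: "(1 - N\<^sup>2 * D / q) * (\<Sum>j\<le>Suc n. ((case j of 0 \<Rightarrow> 0 | Suc i \<Rightarrow> ?t i * aw_alpha a b c d (q ^ i))
      + ?t j * aw_beta q a b c d (q ^ j) + ?t (Suc j) * aw_delta q a b c d (q ^ Suc j)) * aw_basis q a j z)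
    = - (X * ?S (q * N)) + Y * ?S (N / q)" .
  have up: "aw_poly_formula q a b c d (n + 1) z = aw_pre q a b c d n * ((1 - a * b * N) * (1 - a * c * N) * (1 - a * d * N) / a) * ?S (q * N)"
    using aw_poly_formula_eq[OF q, of "n + 1" "Suc n" a b c d z]
    by (simp add: aw_pre_def qp_Suc N_def mult_ac)
  obtain m where m: "n = Suc m"
    using n gr0_implies_Suc by blast
  have M: "M = q ^ m" "M = N / q"
    using q by (simp_all add: M_def N_def m)
  have down: "aw_pre q a b c d n * a * ?S (N / q) = (1 - a * b * M) * (1 - a * c * M) * (1 - a * d * M) * aw_poly_formula q a b c d (n - 1) z"
    using aw_poly_formula_eq[OF q, of "n - 1" "Suc n" a b c d z] a
    unfolding M(2)[symmetric] by (simp add: aw_pre_def qp_Suc M m mult_ac)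
  have "(1 - N\<^sup>2 * D / q) * aw_numerator q a b c d (aw_poly_formula q a b c d n) z
    = (z - inverse z) * (aw_pre q a b c d n * (- (X * ?S (q * N)) + Y * ?S (N / q)))"
    unfolding num S[symmetric] by (simp only: mult_ac)
  also have "aw_pre q a b c d n * (- (X * ?S (q * N)) + Y * ?S (N / q)) =
    - ((1 - N * D / q) / N * (aw_pre q a b c d n * ((1 - a * b * N) * (1 - a * c * N) * (1 - a * d * N) / a) * ?S (q * N)))
     + (1 - b * c * M) * (1 - b * d * M) * (1 - c * d * M) * (1 - N) / M * (aw_pre q a b c d n * a * ?S (N / q))"
  proof -
    have "p * (- (x1 * (x2 / (a * N)) * S1) + a * y1 * y2 * y3 * y4 / M * S2) =
        - (x1 / N * (p * (x2 / a) * S1)) + y1 * y2 * y3 * y4 / M * (p * a * S2)"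
      for p S1 S2 x1 x2 y1 y2 y3 y4
      by (simp add: right_diff_distrib mult_ac)
    then show ?thesis
      unfolding X_def Y_def .
  qed
  also have "\<dots> = - ((1 - N * D / q) / N * aw_poly_formula q a b c d (n + 1) z)
     + (1 - a * b * M) * (1 - a * c * M) * (1 - a * d * M) * (1 - b * c * M) * (1 - b * d * M) * (1 - c * d * M)
       * (1 - N) / M * aw_poly_formula q a b c d (n - 1) z"
    unfolding up[symmetric] down by (simp add: mult_ac)
  finally show ?thesis .
qed

text \<open>At n = 0 both sides of the general relation carry the factor 1 - abcd/q, which vanishes
  if abcd = q. Here that factor is cancelled, so this case has to be computed directly.\<close>

lemma aw_structure_numerator_0:
  assumes z: "z \<noteq> 0"
  shows "aw_numerator q a b c d (aw_poly_formula q a b c d 0) z = (z - inverse z) * - aw_poly_formula q a b c d 1 z"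
proof -
  have [simp]: "aw_coeff q a b c d N' 0 = 1" for N'
    by (simp add: aw_coeff_def)
  have 0: "aw_poly_formula q a b c d 0 = aw_basis q a 0"
    using aw_poly_formula_eq[OF q, of 0 0 a b c d] by (simp add: fun_eq_iff aw_pre_def aw_basis_def)
  define h where "h = (1 - a * b) * (1 - a * c) * (1 - a * d)"
  have H1: "h \<noteq> 0" "1 - q \<noteq> 0"
    using params[of 0] q_root[of 0] by (auto simp: h_def)
  have "aw_poly_formula q a b c d 1 z = h / a * (1 + (1 - 1 / q) * (1 - a * b * c * d) * q / (h * (1 - q)) * aw_basis q a 1 z)"
    using aw_poly_formula_eq[OF q, of 1 1 a b c d z] aw_coeff_Suc[of q 0] q
    by (simp add: aw_pre_def aw_basis_def qp_Suc h_def)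
  also have "\<dots> = h / a - (1 - a * b * c * d) / a * aw_basis q a 1 z"
  proof -
    have "h / a * (1 + (1 - 1 / q) * E * q / (h * (1 - q)) * x) = h / a + (1 / a) * E * ((q - 1) / (1 - q)) * x"
      for E x
      using H1 a q by (simp add: field_simps)
    moreover have "(q - 1) / (1 - q) = -1"
      using H1(2) by (simp add: divide_eq_eq)
    ultimately show ?thesis
      by simp
  qed
  finally have 1: "aw_poly_formula q a b c d 1 z = h / a - (1 - a * b * c * d) / a * aw_basis q a 1 z" .
  have "aw_beta q a b c d 1 = - (h / a)"
    using a q by (simp add: aw_beta_def h_def field_simps power2_eq_square)
  then show ?thesis
    unfolding 0 1 aw_numerator_basis[OF q a z] by (simp add: aw_alpha_def aw_delta_def aw_basis_def)
qed

end

section \<open>Passage to the limit a -> 0\<close>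

lemma lagrange_basis_exists:
  fixes X :: "'a::field set"
  assumes X: "finite X" "card X = Suc n"
  shows "\<exists>l. (\<forall>x\<in>X. degree (l x) \<le> n) \<and>
    (\<forall>p. degree p \<le> n \<longrightarrow> p = (\<Sum>x\<in>X. smult (poly p x) (l x)))"
proof -
  define l where "l x = smult (1 / (\<Prod>y\<in>X - {x}. x - y)) (\<Prod>y\<in>X - {x}. [:- y, 1:])" for x
  have deg: "degree (l x) \<le> n" if "x \<in> X" for x
  proof -
    have "degree (\<Prod>y\<in>X - {x}. [:- y, 1:]) \<le> (\<Sum>y\<in>X - {x}. 1)"
      using X by (intro order.trans[OF degree_prod_sum_le] sum_mono) auto
    also have "\<dots> = n"
      using X that by simp
    finally show ?thesis
      unfolding l_def by (rule order.trans[OF degree_smult_le])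
  qed
  have val: "poly (l x) y = (if x = y then 1 else 0)" if "x \<in> X" "y \<in> X" for x y
    using that X by (auto simp: l_def poly_prod)
  have "p = (\<Sum>x\<in>X. smult (poly p x) (l x))" if p: "degree p \<le> n" for p
  proof (rule poly_eqI_degree[of X])
    show "poly p y = poly (\<Sum>x\<in>X. smult (poly p x) (l x)) y" if "y \<in> X" for y
    proof -
      have "poly (\<Sum>x\<in>X. smult (poly p x) (l x)) y = (\<Sum>x\<in>X. if x = y then poly p x else 0)"
        unfolding poly_sum by (intro sum.cong) (auto simp: val that)
      then show ?thesis
        using X that by simp
    qed
    have "degree (\<Sum>x\<in>X. smult (poly p x) (l x)) \<le> n"
      using X by (intro degree_sum_le) (auto intro: order.trans[OF degree_smult_le] deg)
    then show "degree p < card X" "degree (\<Sum>x\<in>X. smult (poly p x) (l x)) < card X"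
      using p X by auto
  qed
  with deg show ?thesis
    by blast
qed

text \<open>By Lagrange interpolation a polynomial of degree at most n is a fixed linear combination
  of its values at n+1 nodes. Convergence at the nodes thus gives convergence at every nonzero z,
  including z = 1 and z = -1, where nothing is assumed.\<close>

lemma laurent_limit:
  fixes f :: "'b \<Rightarrow> complex \<Rightarrow> complex"
  assumes f: "\<forall>\<^sub>F x in F. \<exists>p. degree p \<le> n \<and> (\<forall>z. z \<noteq> 0 \<longrightarrow> f x z = laurent_of_poly p z)"
    and lim: "\<And>z. z \<noteq> 0 \<Longrightarrow> z\<^sup>2 \<noteq> 1 \<Longrightarrow> \<exists>l. ((\<lambda>x. f x z) \<longlongrightarrow> l) F"
  shows "\<exists>p. degree p \<le> n \<and> (\<forall>z. z \<noteq> 0 \<longrightarrow> ((\<lambda>x. f x z) \<longlongrightarrow> laurent_of_poly p z) F)"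
proof -
  \<comment> \<open>Integers from 2 on avoid 0, 1 and -1, and no two of them have product 1, so the
    corresponding values of x are distinct.\<close>
  define \<zeta> where "\<zeta> k = (of_nat (k + 2) :: complex)" for k
  define \<xi> where "\<xi> k = (\<zeta> k + inverse (\<zeta> k)) / 2" for k
  have \<zeta>: "\<zeta> k \<noteq> 0" "(\<zeta> k)\<^sup>2 \<noteq> 1" for k
  proof -
    show "\<zeta> k \<noteq> 0"
      unfolding \<zeta>_def of_nat_eq_0_iff by simp
    have "(k + 2)\<^sup>2 \<noteq> 1"
      by simp
    then show "(\<zeta> k)\<^sup>2 \<noteq> 1"
      unfolding \<zeta>_def by (metis of_nat_1_eq_iff of_nat_power)
  qed
  have "inj \<xi>"
  proof (rule injI)
    fix j k assume "\<xi> j = \<xi> k"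
    moreover have "\<zeta> i + inverse (\<zeta> i) = 2 * \<xi> i" for i
      by (simp add: \<xi>_def)
    ultimately have "\<zeta> j + inverse (\<zeta> j) = \<zeta> k + inverse (\<zeta> k)"
      by simp
    then have "(\<zeta> j - \<zeta> k) * (\<zeta> j * \<zeta> k - 1) = 0"
      using \<zeta>(1)[of j] \<zeta>(1)[of k] by (simp add: field_simps)
    moreover have "\<zeta> j * \<zeta> k \<noteq> 1"
    proof -
      have "(j + 2) * (k + 2) \<noteq> 1"
        by simp
      then show ?thesis
        unfolding \<zeta>_def by (metis of_nat_1_eq_iff of_nat_mult)
    qed
    ultimately have "\<zeta> j = \<zeta> k"
      by simp
    then show "j = k"
      by (simp add: \<zeta>_def)
  qed
  then have inj: "inj_on \<xi> {..n}"
    by (rule inj_on_subset) simp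
  then have "card (\<xi> ` {..n}) = Suc n"
    by (simp add: card_image)
  then obtain l where l: "\<And>x. x \<in> \<xi> ` {..n} \<Longrightarrow> degree (l x) \<le> n"
    "\<And>p. degree p \<le> n \<Longrightarrow> p = (\<Sum>x\<in>\<xi> ` {..n}. smult (poly p x) (l x))"
    using lagrange_basis_exists[of "\<xi> ` {..n}" n] by auto
  obtain L where L: "\<And>k. ((\<lambda>x. f x (\<zeta> k)) \<longlongrightarrow> L k) F"
    using lim[OF \<zeta>] by metis
  define p where "p = (\<Sum>k\<le>n. smult (L k) (l (\<xi> k)))"
  have "degree p \<le> n"
    unfolding p_def by (intro degree_sum_le) (auto intro!: order.trans[OF degree_smult_le] l(1))
  moreover have "((\<lambda>x. f x z) \<longlongrightarrow> laurent_of_poly p z) F" if z: "z \<noteq> 0" for z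
  proof -
    have "((\<lambda>x. \<Sum>k\<le>n. f x (\<zeta> k) * laurent_of_poly (l (\<xi> k)) z) \<longlongrightarrow> laurent_of_poly p z) F"
      unfolding p_def laurent_of_poly_simps by (intro tendsto_intros L)
    moreover have "\<forall>\<^sub>F x in F. (\<Sum>k\<le>n. f x (\<zeta> k) * laurent_of_poly (l (\<xi> k)) z) = f x z"
      using f
    proof eventually_elim
      case (elim x)
      then obtain r where r: "degree r \<le> n" "\<And>z. z \<noteq> 0 \<Longrightarrow> f x z = laurent_of_poly r z"
        by blast
      have "f x (\<zeta> k) = poly r (\<xi> k)" for k
        using r(2)[OF \<zeta>(1)] by (simp add: laurent_of_poly_def \<xi>_def)
      then have "r = (\<Sum>k\<le>n. smult (f x (\<zeta> k)) (l (\<xi> k)))"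
        using l(2)[OF r(1)] unfolding sum.reindex[OF inj] by simp
      then have "laurent_of_poly r z = laurent_of_poly (\<Sum>k\<le>n. smult (f x (\<zeta> k)) (l (\<xi> k))) z"
        by (rule arg_cong)
      then show ?case
        using r(2)[OF z] by simp
    qed
    ultimately show ?thesis
      by (rule Lim_transform_eventually)
  qed
  ultimately show ?thesis
    by blast
qed

lemma aw_basis_laurent:
  "\<exists>p. degree p \<le> k \<and> (\<forall>z. z \<noteq> 0 \<longrightarrow> aw_basis q a k z = laurent_of_poly p z)"
proof (induction k)
  case 0
  show ?case
    by (intro exI[of _ 1]) (simp add: aw_basis_def)
next
  case (Suc k)
  then obtain p where p: "degree p \<le> k" "\<And>z. z \<noteq> 0 \<Longrightarrow> aw_basis q a k z = laurent_of_poly p z"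
    by blast
  define r where "r = [:1 + (a * q ^ k)\<^sup>2, - (2 * a * q ^ k):]"
  have "laurent_of_poly r z = (1 - a * z * q ^ k) * (1 - a * inverse z * q ^ k)" if "z \<noteq> 0" for z
    using that by (simp add: r_def laurent_of_poly_def field_simps power2_eq_square)
  then have "aw_basis q a (Suc k) z = laurent_of_poly (p * r) z" if "z \<noteq> 0" for z
    using that p(2)[OF that] by (simp add: aw_basis_def qp_Suc mult_ac)
  moreover have "degree (p * r) \<le> Suc k"
    using degree_mult_le[of p r] p(1) by (simp add: r_def split: if_splits)
  ultimately show ?case
    by blast
qed

lemma aw_poly_formula_laurent:
  assumes q: "q \<noteq> 0"
  shows "\<exists>p. degree p \<le> n \<and> (\<forall>z. z \<noteq> 0 \<longrightarrow> aw_poly_formula q a b c d n z = laurent_of_poly p z)"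
proof -
  have "\<exists>p. \<forall>k. degree (p k) \<le> k \<and> (\<forall>z. z \<noteq> 0 \<longrightarrow> aw_basis q a k z = laurent_of_poly (p k) z)"
    by (intro choice allI aw_basis_laurent)
  then obtain p where p: "\<And>k. degree (p k) \<le> k" "\<And>k z. z \<noteq> 0 \<Longrightarrow> aw_basis q a k z = laurent_of_poly (p k) z"
    by blast
  define r where "r = smult (aw_pre q a b c d n) (\<Sum>k\<le>n. smult (aw_coeff q a b c d (q ^ n) k) (p k))"
  have "degree r \<le> n"
    unfolding r_def
  proof (intro order.trans[OF degree_smult_le] degree_sum_le)
    fix k assume "k \<in> {..n}"
    then show "degree (p k) \<le> n"
      using p(1)[of k] by simp
  qed simp
  moreover have "aw_poly_formula q a b c d n z = laurent_of_poly r z" if "z \<noteq> 0" for z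
    using that by (simp add: aw_poly_formula_eq[OF q order.refl] p(2) r_def)
  ultimately show ?thesis
    by blast
qed

text \<open>The arguments \<open>u\<close> and \<open>v\<close> stand for p_(n+1) and p_(n-1).
  Keeping them as variables shows that the expression is affine in \<open>u\<close>, so that the
  relation can be solved for p_(n+1).\<close>

definition aw_structure_rhs ::
  "complex \<Rightarrow> complex \<Rightarrow> complex \<Rightarrow> complex \<Rightarrow> complex \<Rightarrow> nat \<Rightarrow> complex \<Rightarrow> complex \<Rightarrow> complex" where
  "aw_structure_rhs q a b c d n u v = (let N = q ^ n; M = N / q in
     - ((1 - N * (a * b * c * d) / q) / N * u)
     + (1 - a * b * M) * (1 - a * c * M) * (1 - a * d * M) * (1 - b * c * M) * (1 - b * d * M) * (1 - c * d * M)
       * (1 - N) / M * v)"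

text \<open>At n = 0 the truncated index n - 1 is harmless, since its term carries the factor 1 -
  q^0 = 0.\<close>

lemma aw_structure_formula:
  assumes "q \<noteq> 0" "\<And>k. q ^ Suc k \<noteq> 1" "a \<noteq> 0" "\<And>k. a * b * q ^ k \<noteq> 1" "\<And>k. a * c * q ^ k \<noteq> 1" "\<And>k. a * d * q ^ k \<noteq> 1"
    and z: "z \<noteq> 0"
  shows "(1 - (q ^ n)\<^sup>2 * (a * b * c * d) / q) * aw_numerator q a b c d (aw_poly_formula q a b c d n) z =
    (z - inverse z) * aw_structure_rhs q a b c d n (aw_poly_formula q a b c d (n + 1) z) (aw_poly_formula q a b c d (n - 1) z)"
proof (cases n)
  case 0
  then show ?thesis
    using aw_structure_numerator_0[OF assms] by (simp add: aw_structure_rhs_def)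
next
  case (Suc m)
  then have "n > 0"
    by simp
  then show ?thesis
    unfolding aw_structure_rhs_def Let_def by (rule aw_structure_numerator[OF assms(1-6) _ z])
qed

text \<open>One neighbourhood of 0 serves all k at once, because |ab| < 1 and the powers of q have
  modulus at most 1.\<close>

lemma eventually_generic_parameter:
  fixes q b :: complex
  assumes q: "norm q < 1"
  shows "\<forall>\<^sub>F a in at 0. \<forall>k. a * b * q ^ k \<noteq> 1"
proof -
  have "((\<lambda>a. norm (a * b)) \<longlongrightarrow> norm (0 * b)) (at 0)"
    by (intro tendsto_intros)
  then have "\<forall>\<^sub>F a in at 0. norm (a * b) < 1"
    by (rule order_tendstoD) simp
  then show ?thesis
  proof eventually_elim
    case (elim a)
    have "norm (a * b * q ^ k) < 1" for k
    proof -
      have "norm (a * b) * norm q ^ k \<le> norm (a * b) * 1"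
        using q by (intro mult_left_mono power_le_one) auto
      then show ?thesis
        using elim by (simp add: norm_mult norm_power)
    qed
    then show ?case
      by (metis norm_one order_less_irrefl)
  qed
qed

context
  fixes q b c d :: complex
  assumes q: "norm q < 1" "q \<noteq> 0"
begin

lemma q_not_root: "q ^ Suc k \<noteq> 1"
proof
  assume "q ^ Suc k = 1"
  then have "norm q ^ Suc k = 1"
    by (metis norm_one norm_power)
  moreover have "norm q ^ Suc k < 1"
    using q(1) by (intro power_Suc_less_one) (use q in auto)
  ultimately show False
    by simp
qed

lemma aw_structure_eventually:
  assumes z: "z \<noteq> 0"
  shows "\<forall>\<^sub>F a in at 0. (1 - (q ^ n)\<^sup>2 * (a * b * c * d) / q) * aw_numerator q a b c d (aw_poly_formula q a b c d n) z =
    (z - inverse z) * aw_structure_rhs q a b c d n (aw_poly_formula q a b c d (n + 1) z) (aw_poly_formula q a b c d (n - 1) z)"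
proof -
  have "\<forall>\<^sub>F a in at (0::complex). a \<noteq> 0"
    by (rule eventually_neq_at_within)
  with eventually_generic_parameter[OF q(1), of b] eventually_generic_parameter[OF q(1), of c]
    eventually_generic_parameter[OF q(1), of d]
  show ?thesis
    by eventually_elim (rule aw_structure_formula[OF q(2) q_not_root _ _ _ _ z], simp_all)
qed

lemma aw_numerator_tendsto:
  assumes z: "z \<noteq> 0" and f: "\<And>z. z \<noteq> 0 \<Longrightarrow> ((\<lambda>a. f a z) \<longlongrightarrow> g z) (at 0)"
  shows "((\<lambda>a. aw_numerator q a b c d (f a) z) \<longlongrightarrow> aw_numerator q 0 b c d g z) (at 0)"
  unfolding aw_numerator_def using z q by (intro tendsto_intros f) auto

lemma aw_structure_rhs_tendsto:
  assumes "((\<lambda>a. u a) \<longlongrightarrow> u') (at 0)" "((\<lambda>a. v a) \<longlongrightarrow> v') (at 0)"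
  shows "((\<lambda>a. aw_structure_rhs q a b c d n (u a) (v a)) \<longlongrightarrow> aw_structure_rhs q 0 b c d n u' v') (at 0)"
  unfolding aw_structure_rhs_def Let_def using q by (intro tendsto_intros assms) auto

text \<open>The structure relation, read as a recurrence for \<open>p\<^bsub>n+1\<^esub>\<close>, shows that the limit defining the
  polynomials at \<open>a = 0\<close> exists.\<close>

lemma aw_poly_formula_tendsto:
  "\<exists>p. degree p \<le> n \<and> (\<forall>z. z \<noteq> 0 \<longrightarrow> ((\<lambda>a. aw_poly_formula q a b c d n z) \<longlongrightarrow> laurent_of_poly p z) (at 0))"
proof (induction n rule: less_induct)
  case (less n)
  show ?case
  proof (cases n)
    case 0
    have "aw_poly_formula q a b c d 0 z = 1" for a z
      by (simp add: aw_poly_formula_def qpoch_def)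
    then show ?thesis
      using 0 by (intro exI[of _ 1]) simp
  next
    case (Suc m)
    show ?thesis
    proof (rule laurent_limit)
      show "\<forall>\<^sub>F a in at 0. \<exists>p. degree p \<le> n \<and> (\<forall>z. z \<noteq> 0 \<longrightarrow> aw_poly_formula q a b c d n z = laurent_of_poly p z)"
        using aw_poly_formula_laurent[OF q(2)] by simp
      fix z :: complex assume z: "z \<noteq> 0" "z\<^sup>2 \<noteq> 1"
      have nz: "z - inverse z \<noteq> 0"
        by (rule minus_inverse_nonzero[OF z])
      obtain p where p: "\<And>z. z \<noteq> 0 \<Longrightarrow> ((\<lambda>a. aw_poly_formula q a b c d m z) \<longlongrightarrow> laurent_of_poly p z) (at 0)"
        using less[of m] Suc by blast
      obtain p' where p': "\<And>z. z \<noteq> 0 \<Longrightarrow> ((\<lambda>a. aw_poly_formula q a b c d (m - 1) z) \<longlongrightarrow> laurent_of_poly p' z) (at 0)"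
      proof -
        have "m - 1 < n"
          using Suc by simp
        then have "\<exists>p. degree p \<le> m - 1 \<and> (\<forall>z. z \<noteq> 0 \<longrightarrow>
            ((\<lambda>a. aw_poly_formula q a b c d (m - 1) z) \<longlongrightarrow> laurent_of_poly p z) (at 0))"
          by (rule less)
        with that show thesis
          by blast
      qed
      define N where "N = q ^ m"
      \<comment> \<open>\<open>X\<close> is the negated coefficient of p_(m+1) in the structure
        relation, and \<open>R\<close> below is the rest, so that \<open>R a = X a * p_(m+1)\<close>
        for small nonzero a. Since \<open>X\<close> tends to q^(-m), which is not 0, the quotient
        converges.\<close>
      define X where "X a = (1 - N * (a * b * c * d) / q) / N" for a
      define R where "R a = aw_structure_rhs q a b c d m 0 (aw_poly_formula q a b c d (m - 1) z)
         - (1 - N\<^sup>2 * (a * b * c * d) / q) * aw_numerator q a b c d (aw_poly_formula q a b c d m) z / (z - inverse z)" for a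
      have N: "N \<noteq> 0"
        using q by (simp add: N_def)
      have "((\<lambda>a. (1 - N * (a * b * c * d) / q) / N) \<longlongrightarrow> (1 - N * (0 * b * c * d) / q) / N) (at 0)"
        by (intro tendsto_intros) (use q N in auto)
      then have X: "((\<lambda>a. X a) \<longlongrightarrow> 1 / N) (at 0)"
        by (simp add: X_def)
      have X_nz: "\<forall>\<^sub>F a in at 0. X a \<noteq> 0"
        by (rule tendsto_imp_eventually_ne[OF X]) (use N in simp)
      have 1: "((\<lambda>a. aw_structure_rhs q a b c d m 0 (aw_poly_formula q a b c d (m - 1) z))
          \<longlongrightarrow> aw_structure_rhs q 0 b c d m 0 (laurent_of_poly p' z)) (at 0)"
        by (rule aw_structure_rhs_tendsto[OF tendsto_const p'[OF z(1)]])
      \<comment> \<open>The numerator at z involves p_m at qz and z/q. This is why the induction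
        hypothesis must give convergence at every nonzero point, also where the square is 1.\<close>
      have 2: "((\<lambda>a. aw_numerator q a b c d (aw_poly_formula q a b c d m) z)
          \<longlongrightarrow> aw_numerator q 0 b c d (laurent_of_poly p) z) (at 0)"
        by (rule aw_numerator_tendsto[OF z(1) p])
      have 3: "((\<lambda>a. 1 - N\<^sup>2 * (a * b * c * d) / q) \<longlongrightarrow> 1 - N\<^sup>2 * (0 * b * c * d) / q) (at 0)"
        by (intro tendsto_intros) (use q in auto)
      have "((\<lambda>a. R a / X a) \<longlongrightarrow> (aw_structure_rhs q 0 b c d m 0 (laurent_of_poly p' z)
         - (1 - N\<^sup>2 * (0 * b * c * d) / q) * aw_numerator q 0 b c d (laurent_of_poly p) z / (z - inverse z))
         / (1 / N)) (at 0)"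
        unfolding R_def
        by (rule tendsto_divide[OF tendsto_diff[OF 1 tendsto_divide[OF tendsto_mult[OF 3 2] tendsto_const nz]] X], use N in simp)
      moreover have "\<forall>\<^sub>F a in at 0. R a / X a = aw_poly_formula q a b c d n z"
        using X_nz aw_structure_eventually[OF z(1), of m]
      proof eventually_elim
        case (elim a)
        let ?u = "aw_poly_formula q a b c d (m + 1) z" and ?v = "aw_poly_formula q a b c d (m - 1) z"
        have split: "aw_structure_rhs q a b c d m u v = aw_structure_rhs q a b c d m 0 v - X a * u" for u v
          by (simp add: aw_structure_rhs_def X_def N_def Let_def)
        have "R a = aw_structure_rhs q a b c d m 0 ?v - (z - inverse z) * aw_structure_rhs q a b c d m ?u ?v / (z - inverse z)"
          unfolding R_def elim(2)[folded N_def] ..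
        also have "\<dots> = X a * aw_poly_formula q a b c d n z"
          unfolding nonzero_mult_div_cancel_left[OF nz] split[of ?u ?v] Suc by simp
        finally show ?case
          using elim(1) by simp
      qed
      ultimately show "\<exists>l. ((\<lambda>a. aw_poly_formula q a b c d n z) \<longlongrightarrow> l) (at 0)"
        by (intro exI) (rule Lim_transform_eventually)
    qed
  qed
qed

lemma aw_poly_0_tendsto:
  assumes "z \<noteq> 0"
  shows "((\<lambda>a. aw_poly_formula q a b c d n z) \<longlongrightarrow> aw_poly q 0 b c d n z) (at 0)"
proof -
  obtain l where "((\<lambda>a. aw_poly_formula q a b c d n z) \<longlongrightarrow> l) (at 0)"
    using aw_poly_formula_tendsto assms by blast
  then show ?thesis
    by (simp add: aw_poly_def tendsto_Lim)
qed

lemma aw_poly_laurent: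
  "\<exists>p. degree p \<le> n \<and> (\<forall>z. z \<noteq> 0 \<longrightarrow> aw_poly q a b c d n z = laurent_of_poly p z)"
proof (cases "a = 0")
  case True
  obtain p where p: "degree p \<le> n"
    "\<And>z. z \<noteq> 0 \<Longrightarrow> ((\<lambda>a. aw_poly_formula q a b c d n z) \<longlongrightarrow> laurent_of_poly p z) (at 0)"
    using aw_poly_formula_tendsto by blast
  have "aw_poly q 0 b c d n z = laurent_of_poly p z" if "z \<noteq> 0" for z
    using p(2)[OF that] by (simp add: aw_poly_def tendsto_Lim)
  with p(1) True show ?thesis
    by blast
next
  case False
  then show ?thesis
    using aw_poly_formula_laurent[OF q(2)] by (simp add: aw_poly_def)
qed

lemma aw_poly_structure_numerator:
  assumes params: "\<And>k. a * b * q ^ k \<noteq> 1" "\<And>k. a * c * q ^ k \<noteq> 1" "\<And>k. a * d * q ^ k \<noteq> 1"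
    and z: "z \<noteq> 0"
  shows "(1 - (q ^ n)\<^sup>2 * (a * b * c * d) / q) * aw_numerator q a b c d (aw_poly q a b c d n) z =
    (z - inverse z) * aw_structure_rhs q a b c d n (aw_poly q a b c d (n + 1) z) (aw_poly q a b c d (n - 1) z)"
proof (cases "a = 0")
  case False
  then have "aw_poly q a b c d k = aw_poly_formula q a b c d k" for k
    by (simp add: aw_poly_def fun_eq_iff)
  then show ?thesis
    using aw_structure_formula[OF q(2) q_not_root False params z] by simp
next
  case True
  have "((\<lambda>a. (1 - (q ^ n)\<^sup>2 * (a * b * c * d) / q) * aw_numerator q a b c d (aw_poly_formula q a b c d n) z)
     \<longlongrightarrow> (1 - (q ^ n)\<^sup>2 * (0 * b * c * d) / q) * aw_numerator q 0 b c d (aw_poly q 0 b c d n) z) (at 0)"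
    using q by (intro tendsto_intros aw_numerator_tendsto aw_poly_0_tendsto z)
  from Lim_transform_eventually[OF this aw_structure_eventually[OF z]]
  have "((\<lambda>a. (z - inverse z) * aw_structure_rhs q a b c d n (aw_poly_formula q a b c d (n + 1) z) (aw_poly_formula q a b c d (n - 1) z))
     \<longlongrightarrow> (1 - (q ^ n)\<^sup>2 * (0 * b * c * d) / q) * aw_numerator q 0 b c d (aw_poly q 0 b c d n) z) (at 0)" .
  moreover have "((\<lambda>a. (z - inverse z) * aw_structure_rhs q a b c d n (aw_poly_formula q a b c d (n + 1) z) (aw_poly_formula q a b c d (n - 1) z))
     \<longlongrightarrow> (z - inverse z) * aw_structure_rhs q 0 b c d n (aw_poly q 0 b c d (n + 1) z) (aw_poly q 0 b c d (n - 1) z)) (at 0)"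
    by (intro tendsto_intros aw_structure_rhs_tendsto aw_poly_0_tendsto z)
  ultimately show ?thesis
    unfolding True by (rule tendsto_unique[OF at_neq_bot])
qed

lemma continuous_aw_poly:
  assumes "z \<noteq> 0"
  shows "isCont (aw_poly q a b c d n) z"
proof -
  obtain p where p: "\<And>z. z \<noteq> 0 \<Longrightarrow> aw_poly q a b c d n z = laurent_of_poly p z"
    using aw_poly_laurent by blast
  have "\<forall>\<^sub>F w in nhds z. w \<noteq> 0"
    using assms by (rule t1_space_nhds)
  then have "\<forall>\<^sub>F w in nhds z. aw_poly q a b c d n w = laurent_of_poly p w"
    by eventually_elim (rule p)
  then show ?thesis
    using continuous_laurent_of_poly[OF assms] by (simp only: isCont_cong)
qed

lemma aw_L_aw_poly:
  assumes params: "\<And>k. a * b * q ^ k \<noteq> 1" "\<And>k. a * c * q ^ k \<noteq> 1" "\<And>k. a * d * q ^ k \<noteq> 1"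
    and nz: "(q ^ n)\<^sup>2 * (a * b * c * d) / q \<noteq> 1" and z: "z \<noteq> 0"
  shows "aw_L q a b c d (aw_poly q a b c d n) z =
    aw_structure_rhs q a b c d n (aw_poly q a b c d (n + 1) z) (aw_poly q a b c d (n - 1) z)
      / (1 - (q ^ n)\<^sup>2 * (a * b * c * d) / q)"
proof (rule aw_L_eqI[OF z])
  show "isCont (\<lambda>z. aw_structure_rhs q a b c d n (aw_poly q a b c d (n + 1) z) (aw_poly q a b c d (n - 1) z)
      / (1 - (q ^ n)\<^sup>2 * (a * b * c * d) / q)) z"
    unfolding aw_structure_rhs_def Let_def using q nz
    by (intro continuous_intros continuous_aw_poly z) auto
  fix w :: complex assume "w \<noteq> 0"
  have "t * x / t = x" if "t \<noteq> 0" for t x :: complex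
    using that by simp
  from this[of "1 - (q ^ n)\<^sup>2 * (a * b * c * d) / q" "aw_numerator q a b c d (aw_poly q a b c d n) w"] nz
  show "aw_numerator q a b c d (aw_poly q a b c d n) w = (w - inverse w) *
     (aw_structure_rhs q a b c d n (aw_poly q a b c d (n + 1) w) (aw_poly q a b c d (n - 1) w)
      / (1 - (q ^ n)\<^sup>2 * (a * b * c * d) / q))"
    unfolding aw_poly_structure_numerator[OF params \<open>w \<noteq> 0\<close>, of n] by simp
qed

lemma aw_L_aw_poly_0:
  assumes params: "\<And>k. a * b * q ^ k \<noteq> 1" "\<And>k. a * c * q ^ k \<noteq> 1" "\<And>k. a * d * q ^ k \<noteq> 1"
    and z: "z \<noteq> 0"
  shows "aw_L q a b c d (aw_poly q a b c d 0) z = - aw_poly q a b c d 1 z"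
proof (rule aw_L_eqI[OF z])
  show "isCont (\<lambda>z. - aw_poly q a b c d 1 z) z"
    by (intro continuous_intros continuous_aw_poly z)
  fix w :: complex assume w: "w \<noteq> 0"
  show "aw_numerator q a b c d (aw_poly q a b c d 0) w = (w - inverse w) * - aw_poly q a b c d 1 w"
  proof (cases "a = 0")
    \<comment> \<open>For a = 0 the factor 1 - abcd/q equals 1, so the general relation already
      gives the claim.\<close>
    case True
    then show ?thesis
      using aw_poly_structure_numerator[OF params w, of 0] by (simp add: aw_structure_rhs_def)
  next
    case False
    then have "aw_poly q a b c d k = aw_poly_formula q a b c d k" for k
      by (simp add: aw_poly_def fun_eq_iff)
    then show ?thesis
      using aw_structure_numerator_0[OF q(2) q_not_root False params w] by simp
  qed
qed

end

theorem mainTheorem1: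
  fixes q :: real and a b c d :: complex
  assumes q: "0 < q" "q < 1"
    and params: "\<forall>e\<in>{a\<^sup>2, b\<^sup>2, c\<^sup>2, d\<^sup>2, a * b, a * c, a * d, b * c, b * d, c * d}.
                   e \<notin> {complex_of_real q powi (- int k) | k::nat. True}"
  shows
    "(\<forall>n f. sym_laurent_le n f \<longrightarrow> sym_laurent_le (n + 1) (aw_L q a b c d f)) \<and>
     (\<forall>n f. sym_laurent_deg n f \<and> a * b * c * d * q ^ n \<noteq> q powi (- int n) \<longrightarrow>
        sym_laurent_deg (n + 1) (aw_L q a b c d f)) \<and>
     (\<forall>n. \<exists>r :: complex poly. degree r < n + 1 \<and>
        (\<forall>z. z \<noteq> 0 \<longrightarrow>
           aw_L q a b c d (laurent_of_poly (monom 1 n)) z =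
           laurent_of_poly
             (monom (2 * (a * b * c * d * q ^ n - q powi (- int n))) (n + 1) + r) z)) \<and>
     (\<exists>C. aw_contour q a b c d C) \<and>
     (\<forall>C f g. aw_contour q a b c d C \<and> sym_laurent f \<and> sym_laurent g \<longrightarrow>
        aw_inner C q a b c d (aw_L q a b c d f) g = - aw_inner C q a b c d f (aw_L q a b c d g)) \<and>
     (\<forall>n z. z \<noteq> 0 \<and> a * b * c * d * q powi (2 * int n - 1) \<noteq> 1 \<longrightarrow>
        aw_L q a b c d (aw_poly q a b c d n) z =
          - ((1 - a * b * c * d * q powi (int n - 1)) * aw_poly q a b c d (n + 1) z
             / (q ^ n * (1 - a * b * c * d * q powi (2 * int n - 1))))
          + (1 - a * b * q powi (int n - 1)) * (1 - a * c * q powi (int n - 1))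
            * (1 - a * d * q powi (int n - 1)) * (1 - b * c * q powi (int n - 1))
            * (1 - b * d * q powi (int n - 1)) * (1 - c * d * q powi (int n - 1))
            * ((1 - q ^ n) * aw_poly q a b c d (n - 1) z
               / (q powi (int n - 1) * (1 - a * b * c * d * q powi (2 * int n - 1))))) \<and>
     (\<forall>z. z \<noteq> 0 \<longrightarrow> aw_L q a b c d (aw_poly q a b c d 0) z = - aw_poly q a b c d 1 z)"
proof -
  define Q where "Q = complex_of_real q"
  have Q: "norm Q < 1" "Q \<noteq> 0"
    using q by (auto simp: Q_def)
  have Q_simps: "complex_of_real (1 - q ^ n) = 1 - Q ^ n" "complex_of_real (q ^ n) = Q ^ n"
    "complex_of_real (q powi k) = Q powi k" for n k
    by (simp_all add: Q_def)
  \<comment> \<open>The ten conditions in one form: e = f gives the squares, distinct letters give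
    the mixed products.\<close>
  have prods: "e * f * Q ^ n \<noteq> 1" if "e \<in> {a, b, c, d}" "f \<in> {a, b, c, d}" for e f n
  proof
    assume "e * f * Q ^ n = 1"
    then have "e * f = Q powi (- int n)"
      using Q by (simp add: power_int_minus field_simps)
    moreover have "e * f \<in> {a\<^sup>2, b\<^sup>2, c\<^sup>2, d\<^sup>2, a * b, a * c, a * d, b * c, b * d, c * d}"
      using that by (auto simp: power2_eq_square mult.commute)
    ultimately show False
      using params unfolding Q_def by blast
  qed
  have L_poly: "\<exists>r. degree r \<le> n + 1 \<and> coeff r (n + 1) = 2 * (a * b * c * d * Q ^ n - inverse Q ^ n) * coeff p n \<and>
      (\<forall>z. z \<noteq> 0 \<longrightarrow> aw_L Q a b c d f z = laurent_of_poly r z)"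
    if "degree p \<le> n" "\<forall>z. z \<noteq> 0 \<longrightarrow> f z = laurent_of_poly p z" for f p n
    using aw_L_poly[OF Q(2) that(1), of f a b c d] that(2) by metis
  have le: "sym_laurent_le (n + 1) (aw_L Q a b c d f)" if "sym_laurent_le n f" for n f
    using that L_poly unfolding sym_laurent_le_iff_poly by meson
  \<comment> \<open>The degree rises by exactly one because \<gamma>_n is not 0. The conditions on
    products of two parameters alone do not exclude abcd = q^(-2n).\<close>
  have deg: "sym_laurent_deg (n + 1) (aw_L Q a b c d f)"
    if f: "sym_laurent_deg n f" and nz: "a * b * c * d * Q ^ n \<noteq> Q powi (- int n)" for n f
  proof -
    obtain p where p: "degree p \<le> n" "coeff p n \<noteq> 0" "\<forall>z. z \<noteq> 0 \<longrightarrow> f z = laurent_of_poly p z"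
      using f unfolding sym_laurent_deg_iff_poly by blast
    obtain r where r: "degree r \<le> n + 1" "coeff r (n + 1) = 2 * (a * b * c * d * Q ^ n - inverse Q ^ n) * coeff p n"
      "\<forall>z. z \<noteq> 0 \<longrightarrow> aw_L Q a b c d f z = laurent_of_poly r z"
      using L_poly[OF p(1,3)] by blast
    have "coeff r (n + 1) \<noteq> 0"
      unfolding r(2) using p(2) nz by (simp add: power_int_minus power_inverse)
    with r(1,3) show ?thesis
      unfolding sym_laurent_deg_iff_poly by blast
  qed
  have lead: "\<exists>r :: complex poly. degree r < n + 1 \<and> (\<forall>z. z \<noteq> 0 \<longrightarrow>
      aw_L Q a b c d (laurent_of_poly (monom 1 n)) z =
      laurent_of_poly (monom (2 * (a * b * c * d * Q ^ n - Q powi (- int n))) (n + 1) + r) z)" for n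
  proof -
    obtain r where r: "degree r \<le> n + 1"
      "coeff r (n + 1) = 2 * (a * b * c * d * Q ^ n - inverse Q ^ n) * coeff (monom 1 n) n"
      "\<forall>z. z \<noteq> 0 \<longrightarrow> aw_L Q a b c d (laurent_of_poly (monom 1 n)) z = laurent_of_poly r z"
      using L_poly[of "monom 1 n" n "laurent_of_poly (monom 1 n)"] by (auto simp: degree_monom_le)
    define m where "m = monom (2 * (a * b * c * d * Q ^ n - Q powi (- int n))) (n + 1)"
    have "degree (r - m) \<le> n"
    proof (rule degree_le, intro allI impI)
      fix i assume "n < i"
      then consider "i = n + 1" | "n + 1 < i"
        by linarith
      then show "coeff (r - m) i = 0"
        using r(1,2) by cases (simp_all add: m_def power_int_minus power_inverse coeff_eq_0)
    qed
    then show ?thesis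
      unfolding m_def[symmetric] using r(3) by (intro exI[of _ "r - m"]) simp
  qed
  \<comment> \<open>This ensures that skew symmetry, which is stated for all admissible contours, is
    not vacuous.\<close>
  have contour: "\<exists>C. aw_contour Q a b c d C"
    using aw_contour_exists[OF Q] prods by blast
  have skew: "aw_inner C Q a b c d (aw_L Q a b c d f) g = - aw_inner C Q a b c d f (aw_L Q a b c d g)"
    if "aw_contour Q a b c d C" "sym_laurent f" "sym_laurent g" for C f g
    using that by (rule aw_inner_skew[OF Q])
  have rel:
    "aw_L Q a b c d (aw_poly Q a b c d n) z =
          - ((1 - a * b * c * d * Q powi (int n - 1)) * aw_poly Q a b c d (n + 1) z
             / (Q ^ n * (1 - a * b * c * d * Q powi (2 * int n - 1))))
          + (1 - a * b * Q powi (int n - 1)) * (1 - a * c * Q powi (int n - 1))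
            * (1 - a * d * Q powi (int n - 1)) * (1 - b * c * Q powi (int n - 1))
            * (1 - b * d * Q powi (int n - 1)) * (1 - c * d * Q powi (int n - 1))
            * ((1 - Q ^ n) * aw_poly Q a b c d (n - 1) z
               / (Q powi (int n - 1) * (1 - a * b * c * d * Q powi (2 * int n - 1))))"
    if z: "z \<noteq> 0" and nz: "a * b * c * d * Q powi (2 * int n - 1) \<noteq> 1" for n z
  proof -
    have powi_minus_1: "Q powi (int k - 1) = Q ^ k / Q" for k
      using Q by (simp add: power_int_diff)
    have powi: "Q powi (int n - 1) = Q ^ n / Q" "Q powi (2 * int n - 1) = (Q ^ n)\<^sup>2 / Q"
      using powi_minus_1[of n] powi_minus_1[of "n * 2"] by (simp_all add: power_mult mult.commute)
    have D: "(Q ^ n)\<^sup>2 * (a * b * c * d) / Q = a * b * c * d * ((Q ^ n)\<^sup>2 / Q)"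
      "Q ^ n * (a * b * c * d) / Q = a * b * c * d * (Q ^ n / Q)"
      by (simp_all add: mult_ac)
    have "aw_L Q a b c d (aw_poly Q a b c d n) z =
      aw_structure_rhs Q a b c d n (aw_poly Q a b c d (n + 1) z) (aw_poly Q a b c d (n - 1) z)
      / (1 - (Q ^ n)\<^sup>2 * (a * b * c * d) / Q)"
      by (rule aw_L_aw_poly[OF Q _ _ _ _ z]) (use prods nz in \<open>auto simp: powi D\<close>)
    also have "\<dots> = - ((1 - a * b * c * d * Q powi (int n - 1)) * aw_poly Q a b c d (n + 1) z
             / (Q ^ n * (1 - a * b * c * d * Q powi (2 * int n - 1))))
          + (1 - a * b * Q powi (int n - 1)) * (1 - a * c * Q powi (int n - 1))
            * (1 - a * d * Q powi (int n - 1)) * (1 - b * c * Q powi (int n - 1))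
            * (1 - b * d * Q powi (int n - 1)) * (1 - c * d * Q powi (int n - 1))
            * ((1 - Q ^ n) * aw_poly Q a b c d (n - 1) z
               / (Q powi (int n - 1) * (1 - a * b * c * d * Q powi (2 * int n - 1))))"
    proof -
      have "(- (x / N * u) + y1 * y2 * y3 * y4 * y5 * y6 * t / M * v) / s =
          - (x * u / (N * s)) + y1 * y2 * y3 * y4 * y5 * y6 * (t * v / (M * s))"
        for x N u y1 y2 y3 y4 y5 y6 t M v s :: complex
        by (simp add: diff_divide_distrib)
      then show ?thesis
        unfolding aw_structure_rhs_def Let_def powi D .
    qed
    finally show ?thesis .
  qed
  have rel_0: "aw_L Q a b c d (aw_poly Q a b c d 0) z = - aw_poly Q a b c d 1 z" if z: "z \<noteq> 0" for z
    using aw_L_aw_poly_0[OF Q _ _ _ z] prods by simp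
  show ?thesis
    unfolding Q_def[symmetric] Q_simps
    by (intro conjI allI impI; (elim conjE)?;
        (rule contour lead | (rule le deg skew rel rel_0; assumption)))
qed

end
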